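(* In the setting described in the context, let $p\in(1,2)$ and assume that, for every $k\in[1,n]$, $$\big\|H_{k,\varepsilon_k}(X_{k-1},\ldots,X_1,\varepsilon_k)\big\|_{w,p}^p\le A_k(p)$$ for some constants $A_k(p)$. Then, for every $x>0$, $$\mathbb P(|S_n|\ge x)\le\frac{C_p\,B(n,p)}{x^p},$$ where $$C_p=\frac{4p}{p-1}+\frac{8}{2-p}\qquad\text{and}\qquad B(n,p)=\sum_{k=1}^n\big(a_{n-k}(n-k)\big)^pA_k(p).$$
   Context: Let $(\mathcal X,d)$ and $(\mathcal Y,\delta)$ be complete separable metric spaces. Let $(\varepsilon_i)_{i\ge1}$ be independent (not necessarily identically distributed) $\mathcal Y$-valued random variables, with $P_{\varepsilon_k}$ the law of $\varepsilon_k$. Let $(X_i)_{i\le0}$ be a deterministic sequence in $\mathcal X$. For each $m\ge1$ let $F_m:\mathcal X^{\mathbb N}\times\mathcal Y\to\mathcal X$ be measurable, and define recursively $X_m=F_m((X_{m-i})_{i\ge1};\varepsilon_m)$ for $m\ge1$. Assume there are nonnegative numbers $a_i$, $i\ge1$, with $\sum_{i\ge1}a_i<1$, such that for all $m\ge1$ and all sequences $(x_{m-i})_{i\ge1},(x'_{m-i})_{i\ge1}$ in $\mathcal X$, $$\mathbb E\big[d\big(F_m((x_{m-i})_{i\ge1};\varepsilon_m),F_m((x'_{m-i})_{i\ge1};\varepsilon_m)\big)\big]\le\sum_{i=1}^\infty a_i\,d(x_{m-i},x'_{m-i}).$$ Fix $n\ge1$ and let $f:\mathcal X^n\to\mathbb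 R$ satisfy $|f(x_1,\ldots,x_n)-f(x'_1,\ldots,x'_n)|\le\sum_{i=1}^n d(x_i,x'_i)$. Put $S_n=f(X_1,\ldots,X_n)-\mathbb E[f(X_1,\ldots,X_n)]$. The numbers $a_k(k)$, $k\ge0$, are defined recursively by $a_0(0)=1$ and $a_k(k)=1+a_k+\sum_{l=1}^{k-1}a_l(l)\,a_{k-l}$ for $k\ge1$ (so $a_1(1)=1+a_1$). For $k\ge1$, $$H_{k,\varepsilon_k}(X_{k-1},\ldots,X_1,\varepsilon_k)=\int d\big(F_k(X_{k-1},\ldots,X_1,X_0,X_{-1},\ldots;\varepsilon_k),F_k(X_{k-1},\ldots,X_1,X_0,X_{-1},\ldots;y)\big)P_{\varepsilon_k}(dy),$$ which for $k=1$ is $H_{1,\varepsilon_1}(\varepsilon_1)=\int d(F_1(X_0,X_{-1},\ldots;\varepsilon_1),F_1(X_0,X_{-1},\ldots;y))P_{\varepsilon_1}(dy)$. For a real random variable $Z$ and $p\ge1$, the weak moment of order $p$ is $\|Z\|_{w,p}^p=\sup_{x>0}x^p\,\mathbb P(|Z|>x)$. *)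

theory Defs
  imports "HOL-Probability.Probability"
begin

text \<open>
  A complete separable metric space is a type of class \<open>polish_space\<close>, with distance \<open>dist\<close>.
  The past \<open>(x\<^sub>m\<^sub>-\<^sub>i)\<close>, \<open>i \<ge> 1\<close>, is a function \<open>s\<close> on \<open>nat\<close> with \<open>s i\<close> standing for the value at
  time \<open>m - 1 - i\<close>, so the coefficient that goes with \<open>s i\<close> is \<open>a (Suc i)\<close>.
\<close>

definition past :: "(int \<Rightarrow> 'w \<Rightarrow> 'x) \<Rightarrow> nat \<Rightarrow> 'w \<Rightarrow> nat \<Rightarrow> 'x" where
  "past X m \<omega> = (\<lambda>i. X (int m - 1 - int i) \<omega>)"

text \<open>The numbers \<open>a\<^sub>k(k)\<close>; the value \<open>a 0\<close> is never used.\<close>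

fun diag_coeff :: "(nat \<Rightarrow> real) \<Rightarrow> nat \<Rightarrow> real" where
  "diag_coeff a 0 = 1"
| "diag_coeff a (Suc k) = 1 + a (Suc k) + (\<Sum>l = 1..k. diag_coeff a l * a (Suc k - l))"

text \<open>
  \<open>G\<close> is one of the maps \<open>F\<^sub>k\<close>, \<open>P\<close> the law of \<open>\<epsilon>\<^sub>k\<close>, \<open>s\<close> the whole past (including the
  deterministic values at times \<open>\<le> 0\<close>). The integral may be infinite, hence \<open>ennreal\<close>.
\<close>

definition H_dist ::
  "((nat \<Rightarrow> 'x::metric_space) \<times> 'y \<Rightarrow> 'x) \<Rightarrow> 'y measure \<Rightarrow> (nat \<Rightarrow> 'x) \<Rightarrow> 'y \<Rightarrow> ennreal" where
  "H_dist G P s z = (\<integral>\<^sup>+ y. ennreal (dist (G (s, z)) (G (s, y))) \<partial>P)"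

text \<open>
  The \<open>p\<close>-th power of the weak norm of order \<open>p\<close>. The variable is extended real, so that an
  infinite value on an event of positive probability makes the weak moment infinite.
\<close>

definition weak_moment :: "'w measure \<Rightarrow> real \<Rightarrow> ('w \<Rightarrow> ereal) \<Rightarrow> ereal" where
  "weak_moment M p Z =
     (SUP x \<in> {0<..}. ereal (x powr p * measure M {\<omega> \<in> space M. \<bar>Z \<omega>\<bar> > ereal x}))"

definition C_const :: "real \<Rightarrow> real" where
  "C_const p = 4 * p / (p - 1) + 8 / (2 - p)"

definition B_const :: "(nat \<Rightarrow> real) \<Rightarrow> (nat \<Rightarrow> real) \<Rightarrow> nat \<Rightarrow> real \<Rightarrow> real" where
  "B_const a A n p = (\<Sum>k = 1..n. diag_coeff a (n - k) powr p * A k)"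

text \<open>
  \<open>S\<^sub>n\<close>, for \<open>f\<close> a function on the product \<open>{1..n} \<rightarrow>\<^sub>E UNIV\<close>.
\<close>

definition S_dev ::
  "'w measure \<Rightarrow> (int \<Rightarrow> 'w \<Rightarrow> 'x) \<Rightarrow> ((nat \<Rightarrow> 'x) \<Rightarrow> real) \<Rightarrow> nat \<Rightarrow> 'w \<Rightarrow> real" where
  "S_dev M X f n \<omega> =
     f (\<lambda>i\<in>{1..n}. X (int i) \<omega>) - (\<integral>\<omega>'. f (\<lambda>i\<in>{1..n}. X (int i) \<omega>') \<partial>M)"

end

theory Submission
  imports Defs
begin

text \<open>
  The conditional expectations \<open>g\<^sub>k\<close> of \<open>f (X\<^sub>1, \<dots>, X\<^sub>n)\<close> given the past up to time \<open>k\<close> are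
  Lipschitz; integrating out one variable at a time with the contraction hypothesis shows that the
  constant of \<open>g\<^sub>k\<close> in the coordinate at time \<open>k\<close> is \<open>a\<^sub>n\<^sub>-\<^sub>k(n-k)\<close>. Hence \<open>S\<^sub>n\<close> is a sum of martingale
  differences \<open>d\<^sub>k\<close> with \<open>\<bar>d\<^sub>k\<bar> \<le> a\<^sub>n\<^sub>-\<^sub>k(n-k) H\<^sub>k\<close>. To bound \<open>P(\<bar>S\<^sub>n\<bar> \<ge> x)\<close>, truncate each \<open>d\<^sub>k\<close> at level
  \<open>x\<close> and recentre. The truncated differences are orthogonal, and Chebyshev's inequality at level \<open>x/2\<close>
  gives the constant \<open>8/(2-p)\<close>; Markov's inequality at level \<open>x/2\<close> for the remainders gives \<open>4p/(p-1)\<close>.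
\<close>

text \<open>Cutting at the deviation level \<open>x\<close> itself makes both errors of order
  \<open>x powr (- p)\<close>. The tail bound gives \<open>2 / (2 - p)\<close> for the truncated
  second moment, and Chebyshev at \<open>x / 2\<close> multiplies it by 4. It gives
  \<open>p / (p - 1)\<close> for the first moment of what is cut off; recentring costs as much
  again, and Markov at \<open>x / 2\<close> gives another factor 2.

  The other difficulty is that integrability of the value of \<open>f\<close>, and even
  measurability of \<open>X\<close> and \<open>f\<close>, must be derived. Conditional expectations
  are therefore built as explicit functions of a past, integrating against the law of one innovation
  at a time, so that the Lipschitz bounds hold for every admissible past and not just almost surely.
  Admissible pasts agree at all times up to 0, which makes the contraction sums finite.\<close>

section \<open>Truncated moments from a tail bound\<close>

text \<open>Exchanging the integrals turns the inner one into the tail at level \<open>t\<close>.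
  The weight \<open>w\<close> vanishes off \<open>T\<close>, so the tail bound is needed only at the
  levels in \<open>T\<close>.\<close>

lemma (in finite_measure) nn_integral_layer_cake_le:
  fixes u :: "'a \<Rightarrow> real" and w b :: "real \<Rightarrow> ennreal"
  assumes [measurable]: "u \<in> borel_measurable M" "w \<in> borel_measurable borel"
    and tail: "\<And>t. t \<in> T \<Longrightarrow> emeasure M {\<omega> \<in> space M. u \<omega> > t} \<le> b t"
    and w: "\<And>t. t \<notin> T \<Longrightarrow> w t = 0"
  shows "(\<integral>\<^sup>+\<omega>. (\<integral>\<^sup>+t. w t * indicator {t. t < u \<omega>} t \<partial>lborel) \<partial>M) \<le> (\<integral>\<^sup>+t. w t * b t \<partial>lborel)"
proof -
  interpret pair_sigma_finite M lborel ..
  have "(\<integral>\<^sup>+\<omega>. (\<integral>\<^sup>+t. w t * indicator {t. t < u \<omega>} t \<partial>lborel) \<partial>M)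
      = (\<integral>\<^sup>+\<omega>. (\<integral>\<^sup>+t. (\<lambda>(\<omega>, t). w t * indicator {z \<in> space (M \<Otimes>\<^sub>M lborel). snd z < u (fst z)} (\<omega>, t)) (\<omega>, t) \<partial>lborel) \<partial>M)"
    by (intro nn_integral_cong) (auto simp: space_pair_measure split: split_indicator)
  also have "\<dots> = (\<integral>\<^sup>+t. (\<integral>\<^sup>+\<omega>. (\<lambda>(\<omega>, t). w t * indicator {z \<in> space (M \<Otimes>\<^sub>M lborel). snd z < u (fst z)} (\<omega>, t)) (\<omega>, t) \<partial>M) \<partial>lborel)"
    by (intro Fubini'[symmetric]) simp
  also have "\<dots> = (\<integral>\<^sup>+t. (\<integral>\<^sup>+\<omega>. w t * indicator {\<omega> \<in> space M. u \<omega> > t} \<omega> \<partial>M) \<partial>lborel)"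
    by (intro nn_integral_cong) (auto simp: space_pair_measure split: split_indicator)
  also have "\<dots> = (\<integral>\<^sup>+t. w t * emeasure M {\<omega> \<in> space M. u \<omega> > t} \<partial>lborel)"
    by (intro nn_integral_cong nn_integral_cmult_indicator) simp
  also have "\<dots> \<le> (\<integral>\<^sup>+t. w t * b t \<partial>lborel)"
    by (intro nn_integral_mono) (metis mult_left_mono mult_zero_left order_refl tail w zero_le)
  finally show ?thesis .
qed

text \<open>The square of \<open>v\<close> is the integral of \<open>2 * t\<close> over
  \<open>0 < t < v\<close>. Where \<open>u\<close> is at most \<open>x\<close> only levels below
  \<open>x\<close> enter, and elsewhere the truncated variable is 0. What remains is the integral of
  \<open>2 * B * t powr (1 - p)\<close> up to \<open>x\<close>, convergent at 0 because
  \<open>p < 2\<close>.\<close>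

lemma (in finite_measure) truncated_second_moment_le:
  fixes u :: "'a \<Rightarrow> real"
  assumes [measurable]: "u \<in> borel_measurable M" and nonneg: "\<And>\<omega>. u \<omega> \<ge> 0"
    and tail: "\<And>t. t > 0 \<Longrightarrow> measure M {\<omega> \<in> space M. u \<omega> > t} \<le> B / t powr p"
    and "p < 2" "x > 0" "B \<ge> 0"
  shows "(\<integral>\<^sup>+\<omega>. ennreal ((if u \<omega> \<le> x then u \<omega> else 0)\<^sup>2) \<partial>M) \<le> ennreal (2 * B / (2 - p) * x powr (2 - p))"
proof -
  define w where "w = (\<lambda>t::real. ennreal (2 * t) * indicator {0<..<x} t)"
  have [measurable]: "w \<in> borel_measurable borel" unfolding w_def by measurable
  have sq: "(\<integral>\<^sup>+t. ennreal (2 * t) * indicator {0<..<v} t \<partial>lborel) = ennreal (v\<^sup>2)" if "v \<ge> 0" for v :: real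
  proof (rule nn_integral_has_integral_lebesgue')
    have "((\<lambda>t. 2 * t) has_integral 2 * ((v\<^sup>2 - 0\<^sup>2) / 2)) {0..v}"
      using that by (intro has_integral_mult_right ident_has_integral) auto
    then show "((\<lambda>t. 2 * t) has_integral v\<^sup>2) {0<..<v}"
      by (simp add: has_integral_Icc_iff_Ioo)
  qed auto
  have "(\<integral>\<^sup>+\<omega>. ennreal ((if u \<omega> \<le> x then u \<omega> else 0)\<^sup>2) \<partial>M)
      \<le> (\<integral>\<^sup>+\<omega>. (\<integral>\<^sup>+t. w t * indicator {t. t < u \<omega>} t \<partial>lborel) \<partial>M)"
  proof (intro nn_integral_mono)
    fix \<omega>
    show "ennreal ((if u \<omega> \<le> x then u \<omega> else 0)\<^sup>2) \<le> (\<integral>\<^sup>+t. w t * indicator {t. t < u \<omega>} t \<partial>lborel)"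
    proof (cases "u \<omega> \<le> x")
      case True
      then have "(\<integral>\<^sup>+t. w t * indicator {t. t < u \<omega>} t \<partial>lborel) = (\<integral>\<^sup>+t. ennreal (2 * t) * indicator {0<..<u \<omega>} t \<partial>lborel)"
        by (intro nn_integral_cong) (auto simp: w_def split: split_indicator)
      then show ?thesis using True sq[OF nonneg[of \<omega>]] by simp
    qed simp
  qed
  also have "\<dots> \<le> (\<integral>\<^sup>+t. w t * ennreal (B / t powr p) \<partial>lborel)"
    by (rule nn_integral_layer_cake_le[where T = "{0<..}"])
       (auto simp: w_def emeasure_eq_measure \<open>B \<ge> 0\<close> intro!: tail ennreal_leI split: split_indicator)
  also have "\<dots> = (\<integral>\<^sup>+t. ennreal (2 * B * t powr (1 - p)) * indicator {0<..<x} t \<partial>lborel)"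
    using \<open>B \<ge> 0\<close> by (intro nn_integral_cong)
       (auto simp: w_def powr_diff ennreal_mult[symmetric] field_simps split: split_indicator)
  also have "\<dots> = ennreal (2 * B * (x powr (2 - p) / (2 - p)))"
  proof (rule nn_integral_has_integral_lebesgue')
    have "((\<lambda>t. 2 * B * t powr (1 - p)) has_integral 2 * B * (x powr (1 - p + 1) / (1 - p + 1))) {0..x}"
      using assms by (intro has_integral_mult_right has_integral_powr_from_0) auto
    then show "((\<lambda>t. 2 * B * t powr (1 - p)) has_integral 2 * B * (x powr (2 - p) / (2 - p))) {0<..<x}"
      by (simp add: has_integral_Icc_iff_Ioo algebra_simps)
  qed (use \<open>B \<ge> 0\<close> in auto)
  finally show ?thesis by simp
qed

text \<open>Where \<open>u\<close> exceeds \<open>x\<close>, it is \<open>x\<close> plus the length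
  of the interval from \<open>x\<close> to \<open>u\<close>. The tail at \<open>x\<close>
  contributes \<open>B * x powr (1 - p)\<close>, and the levels above \<open>x\<close> contribute
  \<open>1 / (p - 1)\<close> times that, convergent because \<open>p > 1\<close>; the two add up to
  the factor \<open>p / (p - 1)\<close>.\<close>

lemma (in finite_measure) truncated_first_moment_le:
  fixes u :: "'a \<Rightarrow> real"
  assumes [measurable]: "u \<in> borel_measurable M"
    and tail: "\<And>t. t > 0 \<Longrightarrow> measure M {\<omega> \<in> space M. u \<omega> > t} \<le> B / t powr p"
    and "1 < p" "x > 0" "B \<ge> 0"
  shows "(\<integral>\<^sup>+\<omega>. ennreal (if u \<omega> \<le> x then 0 else u \<omega>) \<partial>M) \<le> ennreal (p / (p - 1) * B * x powr (1 - p))"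
proof -
  define w where "w = (\<lambda>t::real. indicator {x..} t :: ennreal)"
  have [measurable]: "w \<in> borel_measurable borel" unfolding w_def by measurable
  have "(\<integral>\<^sup>+\<omega>. ennreal (if u \<omega> \<le> x then 0 else u \<omega>) \<partial>M)
      = (\<integral>\<^sup>+\<omega>. ennreal x * indicator {\<omega> \<in> space M. u \<omega> > x} \<omega> + (\<integral>\<^sup>+t. w t * indicator {t. t < u \<omega>} t \<partial>lborel) \<partial>M)"
  proof (intro nn_integral_cong)
    fix \<omega> assume "\<omega> \<in> space M"
    have "(\<integral>\<^sup>+t. w t * indicator {t. t < u \<omega>} t \<partial>lborel) = (\<integral>\<^sup>+t. indicator {x..<u \<omega>} t \<partial>lborel)"
      by (intro nn_integral_cong) (auto simp: w_def split: split_indicator)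
    then show "ennreal (if u \<omega> \<le> x then 0 else u \<omega>) =
        ennreal x * indicator {\<omega> \<in> space M. u \<omega> > x} \<omega> + (\<integral>\<^sup>+t. w t * indicator {t. t < u \<omega>} t \<partial>lborel)"
      using \<open>x > 0\<close> \<open>\<omega> \<in> space M\<close> by (auto simp: ennreal_plus[symmetric] split: split_indicator simp del: ennreal_plus)
  qed
  also have "\<dots> = ennreal x * emeasure M {\<omega> \<in> space M. u \<omega> > x} + (\<integral>\<^sup>+\<omega>. (\<integral>\<^sup>+t. w t * indicator {t. t < u \<omega>} t \<partial>lborel) \<partial>M)"
  proof (subst nn_integral_add)
    \<comment> \<open>Writing the condition as membership in a subset of the product space exposes
      joint measurability; on \<open>space M\<close> the two indicators agree.\<close>
    have "(\<lambda>\<omega>. \<integral>\<^sup>+t. w t * indicator {z \<in> space (M \<Otimes>\<^sub>M lborel). snd z < u (fst z)} (\<omega>, t) \<partial>lborel) \<in> borel_measurable M"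
      by measurable
    then show "(\<lambda>\<omega>. \<integral>\<^sup>+t. w t * indicator {t. t < u \<omega>} t \<partial>lborel) \<in> borel_measurable M"
      by (rule measurable_cong[THEN iffD1, rotated])
         (intro nn_integral_cong, auto simp: space_pair_measure split: split_indicator)
  qed (auto simp: nn_integral_cmult_indicator)
  also have "\<dots> \<le> ennreal x * ennreal (B / x powr p) + (\<integral>\<^sup>+t. w t * ennreal (B / t powr p) \<partial>lborel)"
    using tail[OF \<open>x > 0\<close>] \<open>x > 0\<close> \<open>B \<ge> 0\<close>
    by (intro add_mono mult_left_mono nn_integral_layer_cake_le[where T = "{x..}"])
       (auto simp: w_def emeasure_eq_measure intro!: tail ennreal_leI)
  also have "(\<integral>\<^sup>+t. w t * ennreal (B / t powr p) \<partial>lborel) = (\<integral>\<^sup>+t. ennreal (B * t powr (- p)) * indicator {x..} t \<partial>lborel)"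
    by (intro nn_integral_cong) (auto simp: w_def powr_minus field_simps split: split_indicator)
  also have "\<dots> = ennreal (B * (- (x powr (- p + 1)) / (- p + 1)))"
    using assms by (intro nn_integral_has_integral_lebesgue' has_integral_mult_right has_integral_powr_to_inf) auto
  also have "ennreal x * ennreal (B / x powr p) + \<dots> = ennreal (p / (p - 1) * B * x powr (1 - p))"
  proof -
    have "- (x powr (- p + 1)) / (- p + 1) = x powr (1 - p) / (p - 1)"
      by (metis add.commute minus_diff_eq minus_divide_divide uminus_add_conv_diff)
    moreover have "x * (B / x powr p) = B * x powr (1 - p)"
      using \<open>x > 0\<close> by (simp add: powr_diff)
    ultimately have "ennreal x * ennreal (B / x powr p) + ennreal (B * (- (x powr (- p + 1)) / (- p + 1)))
        = ennreal (B * x powr (1 - p) + B * (x powr (1 - p) / (p - 1)))"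
      using assms by (simp add: ennreal_mult[symmetric] ennreal_plus[symmetric] del: ennreal_plus)
    also have "B * x powr (1 - p) + B * (x powr (1 - p) / (p - 1)) = p / (p - 1) * B * x powr (1 - p)"
      using \<open>1 < p\<close> by (simp add: field_simps)
    finally show ?thesis .
  qed
  finally show ?thesis .
qed


text \<open>Cut at level 1: the part below is bounded, and the part above falls under
  \<open>truncated_first_moment_le\<close>.\<close>

lemma (in prob_space) integrable_weak_tail:
  fixes u :: "'a \<Rightarrow> real"
  assumes [measurable]: "u \<in> borel_measurable M"
    and tail: "\<And>t. t > 0 \<Longrightarrow> prob {\<omega> \<in> space M. \<bar>u \<omega>\<bar> > t} \<le> B / t powr p"
    and "1 < p" "B \<ge> 0"
  shows "integrable M u"
proof (rule integrableI_bounded)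
  have "(\<integral>\<^sup>+\<omega>. ennreal (norm (u \<omega>)) \<partial>M) \<le> (\<integral>\<^sup>+\<omega>. 1 + ennreal (if \<bar>u \<omega>\<bar> \<le> 1 then 0 else \<bar>u \<omega>\<bar>) \<partial>M)"
    by (intro nn_integral_mono) (auto simp: ennreal_le_1)
  also have "\<dots> = 1 + (\<integral>\<^sup>+\<omega>. ennreal (if \<bar>u \<omega>\<bar> \<le> 1 then 0 else \<bar>u \<omega>\<bar>) \<partial>M)"
    by (subst nn_integral_add) (auto simp: emeasure_space_1)
  also have "\<dots> \<le> 1 + ennreal (p / (p - 1) * B * 1 powr (1 - p))"
    using assms by (intro add_left_mono truncated_first_moment_le) auto
  also have "\<dots> < \<infinity>" by (simp add: ennreal_add_less_top)
  finally show "(\<integral>\<^sup>+\<omega>. ennreal (norm (u \<omega>)) \<partial>M) < \<infinity>" .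
qed simp

section \<open>Orthogonality and conditional centring\<close>

lemma (in prob_space) finite_measure_subalgebraI:
  "subalgebra M G \<Longrightarrow> finite_measure_subalgebra M G"
  by unfold_locales

lemma integrable_mult_square_integrable:
  fixes u v :: "'a \<Rightarrow> real"
  assumes [measurable]: "u \<in> borel_measurable M" "v \<in> borel_measurable M"
    and "integrable M (\<lambda>\<omega>. (u \<omega>)\<^sup>2)" "integrable M (\<lambda>\<omega>. (v \<omega>)\<^sup>2)"
  shows "integrable M (\<lambda>\<omega>. u \<omega> * v \<omega>)"
proof (rule Bochner_Integration.integrable_bound)
  show "integrable M (\<lambda>\<omega>. (u \<omega>)\<^sup>2 + (v \<omega>)\<^sup>2)" using assms by simp
  have "\<bar>a * b\<bar> \<le> a\<^sup>2 + b\<^sup>2" for a b :: real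
  proof -
    have "2 * \<bar>a * b\<bar> \<le> a\<^sup>2 + b\<^sup>2"
      using sum_squares_bound[of "\<bar>a\<bar>" "\<bar>b\<bar>"] by (simp add: abs_mult mult.assoc)
    then show ?thesis using abs_ge_zero[of "a * b"] by linarith
  qed
  then show "AE \<omega> in M. norm (u \<omega> * v \<omega>) \<le> norm ((u \<omega>)\<^sup>2 + (v \<omega>)\<^sup>2)" by simp
qed simp

text \<open>\<open>G k\<close> is the information before the \<open>k\<close>-th term. A partial sum
  \<open>S\<close> up to \<open>m\<close> is measurable for \<open>G (Suc m)\<close>, so in the mean
  of \<open>S * U (Suc m)\<close> the second factor may be replaced by its conditional expectation,
  which is 0.\<close>

lemma (in prob_space) martingale_difference_second_moment:
  fixes U :: "nat \<Rightarrow> 'a \<Rightarrow> real" and G :: "nat \<Rightarrow> 'a measure"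
  assumes sub: "\<And>k. k \<in> {1..n} \<Longrightarrow> subalgebra M (G k)"
    and adapted: "\<And>j k. 1 \<le> j \<Longrightarrow> j < k \<Longrightarrow> k \<le> n \<Longrightarrow> U j \<in> borel_measurable (G k)"
    and meas: "\<And>k. k \<in> {1..n} \<Longrightarrow> U k \<in> borel_measurable M"
    and sq: "\<And>k. k \<in> {1..n} \<Longrightarrow> integrable M (\<lambda>\<omega>. (U k \<omega>)\<^sup>2)"
    and zero: "\<And>k. k \<in> {1..n} \<Longrightarrow> AE \<omega> in M. real_cond_exp M (G k) (U k) \<omega> = 0"
  shows "integrable M (\<lambda>\<omega>. (\<Sum>k = 1..n. U k \<omega>)\<^sup>2)"
    and "(\<integral>\<omega>. (\<Sum>k = 1..n. U k \<omega>)\<^sup>2 \<partial>M) = (\<Sum>k = 1..n. \<integral>\<omega>. (U k \<omega>)\<^sup>2 \<partial>M)"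
proof -
  have "integrable M (\<lambda>\<omega>. (\<Sum>k = 1..m. U k \<omega>)\<^sup>2) \<and>
      (\<integral>\<omega>. (\<Sum>k = 1..m. U k \<omega>)\<^sup>2 \<partial>M) = (\<Sum>k = 1..m. \<integral>\<omega>. (U k \<omega>)\<^sup>2 \<partial>M)" if "m \<le> n" for m
    using that
  proof (induction m)
    case (Suc m)
    define S where "S = (\<lambda>\<omega>. \<Sum>k = 1..m. U k \<omega>)"
    interpret finite_measure_subalgebra M "G (Suc m)"
      by (rule finite_measure_subalgebraI) (use sub Suc.prems in auto)
    have SG: "S \<in> borel_measurable (G (Suc m))"
      unfolding S_def using adapted Suc.prems by (intro borel_measurable_sum) auto
    have SM [measurable]: "S \<in> borel_measurable M"
      using SG subalg by (rule measurable_from_subalg[rotated])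
    have UM [measurable]: "U (Suc m) \<in> borel_measurable M" using meas Suc.prems by auto
    have iS: "integrable M (\<lambda>\<omega>. (S \<omega>)\<^sup>2)" and iU: "integrable M (\<lambda>\<omega>. (U (Suc m) \<omega>)\<^sup>2)"
      using Suc sq by (auto simp: S_def)
    have iSU: "integrable M (\<lambda>\<omega>. S \<omega> * U (Suc m) \<omega>)"
      using iS iU by (intro integrable_mult_square_integrable) auto
    have "(\<integral>\<omega>. S \<omega> * U (Suc m) \<omega> \<partial>M) = (\<integral>\<omega>. S \<omega> * real_cond_exp M (G (Suc m)) (U (Suc m)) \<omega> \<partial>M)"
      using real_cond_exp_intg(2)[OF iSU SG UM] by simp
    also have "\<dots> = (\<integral>\<omega>. 0 \<partial>M)"
      using zero[of "Suc m"] Suc.prems by (intro integral_cong_AE) auto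
    finally have cross: "(\<integral>\<omega>. S \<omega> * U (Suc m) \<omega> \<partial>M) = 0" by simp
    have expand: "(\<Sum>k = 1..Suc m. U k \<omega>)\<^sup>2 = (S \<omega>)\<^sup>2 + (U (Suc m) \<omega>)\<^sup>2 + 2 * (S \<omega> * U (Suc m) \<omega>)" for \<omega>
      by (simp add: S_def power2_sum)
    show ?case
      unfolding expand using iS iU iSU cross Suc by (simp add: S_def)
  qed simp
  then show "integrable M (\<lambda>\<omega>. (\<Sum>k = 1..n. U k \<omega>)\<^sup>2)"
    and "(\<integral>\<omega>. (\<Sum>k = 1..n. U k \<omega>)\<^sup>2 \<partial>M) = (\<Sum>k = 1..n. \<integral>\<omega>. (U k \<omega>)\<^sup>2 \<partial>M)" by auto
qed

context finite_measure_subalgebra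
begin

lemma real_cond_exp_norm_bound:
  assumes f: "integrable M f" and bound: "\<And>\<omega>. \<bar>f \<omega>\<bar> \<le> c"
  shows "AE \<omega> in M. \<bar>real_cond_exp M F f \<omega>\<bar> \<le> c"
proof -
  have "AE \<omega> in M. real_cond_exp M F f \<omega> \<le> c"
    by (rule real_cond_exp_le_c[OF f]) (use bound in \<open>auto intro!: AE_I2 simp: abs_le_iff\<close>)
  moreover have "AE \<omega> in M. real_cond_exp M F f \<omega> \<ge> - c"
    by (rule real_cond_exp_ge_c[OF f]) (use bound in \<open>auto intro!: AE_I2 simp: abs_le_iff minus_le_iff\<close>)
  ultimately show ?thesis by eventually_elim auto
qed

text \<open>The mean of \<open>e * f\<close> equals that of the square of \<open>e\<close>, so
  centring lowers the second moment by exactly the second moment of \<open>e\<close>. Boundedness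
  supplies all the integrability.\<close>

lemma bounded_centering:
  assumes [measurable]: "f \<in> borel_measurable M" and bound: "\<And>\<omega>. \<bar>f \<omega>\<bar> \<le> c"
  defines "e \<equiv> real_cond_exp M F f"
  shows "integrable M (\<lambda>\<omega>. (f \<omega> - e \<omega>)\<^sup>2)"
    and "(\<integral>\<omega>. (f \<omega> - e \<omega>)\<^sup>2 \<partial>M) \<le> (\<integral>\<omega>. (f \<omega>)\<^sup>2 \<partial>M)"
    and "AE \<omega> in M. real_cond_exp M F (\<lambda>\<omega>. f \<omega> - e \<omega>) \<omega> = 0"
proof -
  have f: "integrable M f"
    by (rule integrable_const_bound[where B = c]) (use bound in auto)
  have [measurable]: "e \<in> borel_measurable M" and eF: "e \<in> borel_measurable F"
    by (auto simp: e_def)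
  have eb: "AE \<omega> in M. \<bar>e \<omega>\<bar> \<le> c"
    unfolding e_def by (rule real_cond_exp_norm_bound[OF f bound])
  have sqf: "integrable M (\<lambda>\<omega>. (f \<omega>)\<^sup>2)"
    by (rule integrable_const_bound[where B = "c\<^sup>2"])
       (use power_mono[OF bound abs_ge_zero, of _ 2] in auto)
  have sqe: "integrable M (\<lambda>\<omega>. (e \<omega>)\<^sup>2)"
    by (rule integrable_const_bound[where B = "c\<^sup>2"])
       (use eb in \<open>auto elim!: eventually_mono dest: power_mono[OF _ abs_ge_zero, of _ _ 2]\<close>)
  have prod: "integrable M (\<lambda>\<omega>. e \<omega> * f \<omega>)"
    using sqe sqf by (intro integrable_mult_square_integrable) auto
  have ef: "(\<integral>\<omega>. e \<omega> * f \<omega> \<partial>M) = (\<integral>\<omega>. (e \<omega>)\<^sup>2 \<partial>M)"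
    using real_cond_exp_intg(2)[OF prod eF] by (simp add: e_def power2_eq_square)
  have expand: "(f \<omega> - e \<omega>)\<^sup>2 = (f \<omega>)\<^sup>2 + (e \<omega>)\<^sup>2 - 2 * (e \<omega> * f \<omega>)" for \<omega>
    by (simp add: power2_diff)
  show "integrable M (\<lambda>\<omega>. (f \<omega> - e \<omega>)\<^sup>2)"
    unfolding expand using sqf sqe prod by simp
  have "(\<integral>\<omega>. (f \<omega> - e \<omega>)\<^sup>2 \<partial>M) = (\<integral>\<omega>. (f \<omega>)\<^sup>2 \<partial>M) - (\<integral>\<omega>. (e \<omega>)\<^sup>2 \<partial>M)"
    unfolding expand using sqf sqe prod ef by simp
  then show "(\<integral>\<omega>. (f \<omega> - e \<omega>)\<^sup>2 \<partial>M) \<le> (\<integral>\<omega>. (f \<omega>)\<^sup>2 \<partial>M)"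
    by simp
  have e: "integrable M e" unfolding e_def using f by (rule real_cond_exp_int)
  show "AE \<omega> in M. real_cond_exp M F (\<lambda>\<omega>. f \<omega> - e \<omega>) \<omega> = 0"
    using real_cond_exp_diff[OF f e] real_cond_exp_F_meas[OF e eF]
    by eventually_elim (simp add: e_def)
qed

lemma nn_integral_real_cond_exp_abs_le:
  assumes [measurable]: "f \<in> borel_measurable M"
  shows "(\<integral>\<^sup>+\<omega>. ennreal \<bar>real_cond_exp M F f \<omega>\<bar> \<partial>M) \<le> (\<integral>\<^sup>+\<omega>. ennreal \<bar>f \<omega>\<bar> \<partial>M)"
proof -
  have "(\<integral>\<^sup>+\<omega>. ennreal \<bar>real_cond_exp M F f \<omega>\<bar> \<partial>M) \<le> (\<integral>\<^sup>+\<omega>. nn_cond_exp M F (\<lambda>\<omega>. ennreal \<bar>f \<omega>\<bar>) \<omega> \<partial>M)"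
    by (rule nn_integral_mono_AE[OF real_cond_exp_abs]) simp
  also have "\<dots> = (\<integral>\<^sup>+\<omega>. ennreal \<bar>f \<omega>\<bar> \<partial>M)"
    using nn_cond_exp_intg[of "\<lambda>_. 1" "\<lambda>\<omega>. ennreal \<bar>f \<omega>\<bar>"] by simp
  finally show ?thesis .
qed

end

section \<open>A weak-type inequality for martingale differences\<close>

theorem (in prob_space) weak_type_martingale_inequality:
  fixes d :: "nat \<Rightarrow> 'a \<Rightarrow> real" and G :: "nat \<Rightarrow> 'a measure"
  assumes sub: "\<And>k. k \<in> {1..n} \<Longrightarrow> subalgebra M (G k)"
    and mono: "\<And>j k. 1 \<le> j \<Longrightarrow> j < k \<Longrightarrow> k \<le> n \<Longrightarrow> subalgebra (G k) (G j)"
    and adapted: "\<And>j k. 1 \<le> j \<Longrightarrow> j < k \<Longrightarrow> k \<le> n \<Longrightarrow> d j \<in> borel_measurable (G k)"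
    and meas: "\<And>k. k \<in> {1..n} \<Longrightarrow> d k \<in> borel_measurable M"
    and zero: "\<And>k. k \<in> {1..n} \<Longrightarrow> AE \<omega> in M. real_cond_exp M (G k) (d k) \<omega> = 0"
    and tail: "\<And>k t. k \<in> {1..n} \<Longrightarrow> t > 0 \<Longrightarrow> prob {\<omega> \<in> space M. \<bar>d k \<omega>\<bar> > t} \<le> b k / t powr p"
    and b: "\<And>k. k \<in> {1..n} \<Longrightarrow> b k \<ge> 0"
    and p: "1 < p" "p < 2" and x: "x > 0"
  shows "prob {\<omega> \<in> space M. \<bar>\<Sum>k = 1..n. d k \<omega>\<bar> \<ge> x} \<le> C_const p * (\<Sum>k = 1..n. b k) / x powr p"
proof -
  define d1 where "d1 = (\<lambda>k \<omega>. if \<bar>d k \<omega>\<bar> \<le> x then d k \<omega> else 0)"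
  define d2 where "d2 = (\<lambda>k \<omega>. d k \<omega> - d1 k \<omega>)"
  define e where "e = (\<lambda>k. real_cond_exp M (G k) (d1 k))"
  \<comment> \<open>\<open>U\<close> is the truncated part recentred to be a martingale difference
    again; \<open>V\<close> collects the rest, so that \<open>d k\<close> is the sum of
    \<open>U k\<close> and \<open>V k\<close>.\<close>
  define U where "U = (\<lambda>k \<omega>. d1 k \<omega> - e k \<omega>)"
  define V where "V = (\<lambda>k \<omega>. d2 k \<omega> + e k \<omega>)"
  have d1_meas: "d1 k \<in> borel_measurable N" if "d k \<in> borel_measurable N" for k N
    using that unfolding d1_def by measurable
  have d1_bound: "\<bar>d1 k \<omega>\<bar> \<le> x" for k \<omega> using x by (simp add: d1_def)
  have e_meas: "e k \<in> borel_measurable (G k)" for k by (simp add: e_def)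
  have meas_M: "d1 k \<in> borel_measurable M" "d2 k \<in> borel_measurable M" "e k \<in> borel_measurable M"
      "U k \<in> borel_measurable M" "V k \<in> borel_measurable M" if k: "k \<in> {1..n}" for k
  proof -
    note [measurable] = meas[OF k] d1_meas[OF meas[OF k]]
    have [measurable]: "e k \<in> borel_measurable M" unfolding e_def by simp
    show "d1 k \<in> borel_measurable M" "d2 k \<in> borel_measurable M" "e k \<in> borel_measurable M"
      "U k \<in> borel_measurable M" "V k \<in> borel_measurable M"
      unfolding d2_def U_def V_def by measurable
  qed
  have second: "(\<integral>\<omega>. (d1 k \<omega>)\<^sup>2 \<partial>M) \<le> 2 * b k / (2 - p) * x powr (2 - p)" if k: "k \<in> {1..n}" for k
  proof (rule integral_real_bounded)
    have "(\<integral>\<^sup>+\<omega>. ennreal ((d1 k \<omega>)\<^sup>2) \<partial>M) = (\<integral>\<^sup>+\<omega>. ennreal ((if \<bar>d k \<omega>\<bar> \<le> x then \<bar>d k \<omega>\<bar> else 0)\<^sup>2) \<partial>M)"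
      by (intro nn_integral_cong) (simp add: d1_def)
    also have "\<dots> \<le> ennreal (2 * b k / (2 - p) * x powr (2 - p))"
      using meas[OF k] tail[OF k] b[OF k] p x by (intro truncated_second_moment_le) auto
    finally show "(\<integral>\<^sup>+\<omega>. ennreal ((d1 k \<omega>)\<^sup>2) \<partial>M) \<le> ennreal (2 * b k / (2 - p) * x powr (2 - p))" .
  qed (use b[OF k] p in auto)
  have first: "(\<integral>\<^sup>+\<omega>. ennreal \<bar>V k \<omega>\<bar> \<partial>M) \<le> ennreal (2 * (p / (p - 1) * b k * x powr (1 - p)))" if k: "k \<in> {1..n}" for k
  proof -
    interpret finite_measure_subalgebra M "G k" by (rule finite_measure_subalgebraI[OF sub[OF k]])
    note [measurable] = meas_M[OF k]
    have int_d: "integrable M (d k)"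
      using meas[OF k] tail[OF k] b[OF k] p by (intro integrable_weak_tail) auto
    have int_d1: "integrable M (d1 k)"
      by (rule integrable_const_bound[where B = x]) (use d1_bound in auto)
    \<comment> \<open>Since \<open>d k\<close> has conditional mean 0, \<open>e k\<close> is minus
      the conditional mean of the remainder \<open>d2 k\<close>. Hence the recentring term is
      bounded in mean by the remainder itself, which yields the factor 2 in the bound on
      \<open>V k\<close>.\<close>
    have "AE \<omega> in M. \<bar>e k \<omega>\<bar> = \<bar>real_cond_exp M (G k) (d2 k) \<omega>\<bar>"
      using real_cond_exp_diff[OF int_d int_d1] zero[OF k]
      by eventually_elim (simp add: e_def d2_def)
    then have "(\<integral>\<^sup>+\<omega>. ennreal \<bar>e k \<omega>\<bar> \<partial>M) = (\<integral>\<^sup>+\<omega>. ennreal \<bar>real_cond_exp M (G k) (d2 k) \<omega>\<bar> \<partial>M)"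
      by (intro nn_integral_cong_AE) auto
    also have "\<dots> \<le> (\<integral>\<^sup>+\<omega>. ennreal \<bar>d2 k \<omega>\<bar> \<partial>M)"
      by (rule nn_integral_real_cond_exp_abs_le) simp
    finally have e_le: "(\<integral>\<^sup>+\<omega>. ennreal \<bar>e k \<omega>\<bar> \<partial>M) \<le> (\<integral>\<^sup>+\<omega>. ennreal \<bar>d2 k \<omega>\<bar> \<partial>M)" .
    have "(\<integral>\<^sup>+\<omega>. ennreal \<bar>d2 k \<omega>\<bar> \<partial>M) = (\<integral>\<^sup>+\<omega>. ennreal (if \<bar>d k \<omega>\<bar> \<le> x then 0 else \<bar>d k \<omega>\<bar>) \<partial>M)"
      by (intro nn_integral_cong) (simp add: d1_def d2_def)
    also have "\<dots> \<le> ennreal (p / (p - 1) * b k * x powr (1 - p))"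
      using meas[OF k] tail[OF k] b[OF k] p x by (intro truncated_first_moment_le) auto
    finally have d2_le: "(\<integral>\<^sup>+\<omega>. ennreal \<bar>d2 k \<omega>\<bar> \<partial>M) \<le> ennreal (p / (p - 1) * b k * x powr (1 - p))" .
    have "(\<integral>\<^sup>+\<omega>. ennreal \<bar>V k \<omega>\<bar> \<partial>M) \<le> (\<integral>\<^sup>+\<omega>. ennreal \<bar>d2 k \<omega>\<bar> + ennreal \<bar>e k \<omega>\<bar> \<partial>M)"
      by (intro nn_integral_mono) (simp add: V_def ennreal_plus[symmetric] abs_triangle_ineq del: ennreal_plus)
    also have "\<dots> = (\<integral>\<^sup>+\<omega>. ennreal \<bar>d2 k \<omega>\<bar> \<partial>M) + (\<integral>\<^sup>+\<omega>. ennreal \<bar>e k \<omega>\<bar> \<partial>M)"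
      by (intro nn_integral_add) auto
    also have "\<dots> \<le> ennreal (p / (p - 1) * b k * x powr (1 - p)) + ennreal (p / (p - 1) * b k * x powr (1 - p))"
      using d2_le e_le by (intro add_mono) auto
    also have "\<dots> = ennreal (2 * (p / (p - 1) * b k * x powr (1 - p)))"
      using b[OF k] p by (simp add: ennreal_plus[symmetric] del: ennreal_plus)
    finally show ?thesis .
  qed
  define SU where "SU = (\<lambda>\<omega>. \<Sum>k = 1..n. U k \<omega>)"
  define SV where "SV = (\<lambda>\<omega>. \<Sum>k = 1..n. V k \<omega>)"
  have [measurable]: "SU \<in> borel_measurable M" "SV \<in> borel_measurable M"
    unfolding SU_def SV_def by (auto intro!: borel_measurable_sum meas_M)
  define b' where "b' = (\<Sum>k = 1..n. b k)"
  have b'0: "b' \<ge> 0" unfolding b'_def by (intro sum_nonneg b)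
  have U_props: "integrable M (\<lambda>\<omega>. (U k \<omega>)\<^sup>2)" "(\<integral>\<omega>. (U k \<omega>)\<^sup>2 \<partial>M) \<le> (\<integral>\<omega>. (d1 k \<omega>)\<^sup>2 \<partial>M)"
      "AE \<omega> in M. real_cond_exp M (G k) (U k) \<omega> = 0" if k: "k \<in> {1..n}" for k
  proof -
    interpret finite_measure_subalgebra M "G k" by (rule finite_measure_subalgebraI[OF sub[OF k]])
    show "integrable M (\<lambda>\<omega>. (U k \<omega>)\<^sup>2)" "(\<integral>\<omega>. (U k \<omega>)\<^sup>2 \<partial>M) \<le> (\<integral>\<omega>. (d1 k \<omega>)\<^sup>2 \<partial>M)"
      "AE \<omega> in M. real_cond_exp M (G k) (U k) \<omega> = 0"
      using bounded_centering[OF meas_M(1)[OF k] d1_bound] by (simp_all add: U_def e_def)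
  qed
  have U_adapted: "U j \<in> borel_measurable (G k)" if "1 \<le> j" "j < k" "k \<le> n" for j k
    unfolding U_def using that
    by (intro borel_measurable_diff d1_meas adapted measurable_from_subalg[OF mono e_meas]) auto
  have SU2: "integrable M (\<lambda>\<omega>. (SU \<omega>)\<^sup>2)" "(\<integral>\<omega>. (SU \<omega>)\<^sup>2 \<partial>M) = (\<Sum>k = 1..n. \<integral>\<omega>. (U k \<omega>)\<^sup>2 \<partial>M)"
    unfolding SU_def using sub U_adapted meas_M(4) U_props(1,3)
    by (intro martingale_difference_second_moment[where G = G]; blast)+
  have "(\<integral>\<omega>. (SU \<omega>)\<^sup>2 \<partial>M) \<le> (\<Sum>k = 1..n. 2 * b k / (2 - p) * x powr (2 - p))"
    unfolding SU2(2) by (intro sum_mono order_trans[OF U_props(2) second])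
  also have "\<dots> = 2 * b' / (2 - p) * x powr (2 - p)"
    by (simp add: b'_def sum_distrib_left sum_distrib_right sum_divide_distrib)
  finally have SU_le: "(\<integral>\<omega>. (SU \<omega>)\<^sup>2 \<partial>M) \<le> 2 * b' / (2 - p) * x powr (2 - p)" .
  have "prob {\<omega> \<in> space M. (SU \<omega>)\<^sup>2 \<ge> (x / 2)\<^sup>2} \<le> (\<integral>\<omega>. (SU \<omega>)\<^sup>2 \<partial>M) / (x / 2)\<^sup>2"
    using x SU2 by (intro integral_Markov_inequality_measure[where A = "space M"]) auto
  also have "\<dots> \<le> (2 * b' / (2 - p) * x powr (2 - p)) / (x / 2)\<^sup>2"
    using SU_le by (intro divide_right_mono) auto
  also have "\<dots> = 8 / (2 - p) * b' / x powr p"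
    using x p by (simp add: powr_diff field_simps power2_eq_square)
  finally have SU_tail: "prob {\<omega> \<in> space M. (SU \<omega>)\<^sup>2 \<ge> (x / 2)\<^sup>2} \<le> 8 / (2 - p) * b' / x powr p" .
  have "(\<integral>\<^sup>+\<omega>. ennreal \<bar>SV \<omega>\<bar> \<partial>M) \<le> (\<integral>\<^sup>+\<omega>. (\<Sum>k = 1..n. ennreal \<bar>V k \<omega>\<bar>) \<partial>M)"
    unfolding SV_def by (intro nn_integral_mono) (simp add: ennreal_leI)
  also have "\<dots> = (\<Sum>k = 1..n. \<integral>\<^sup>+\<omega>. ennreal \<bar>V k \<omega>\<bar> \<partial>M)"
    using meas_M(5) by (intro nn_integral_sum) auto
  also have "\<dots> \<le> (\<Sum>k = 1..n. ennreal (2 * (p / (p - 1) * b k * x powr (1 - p))))"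
    by (intro sum_mono first)
  also have "\<dots> = ennreal (\<Sum>k = 1..n. 2 * (p / (p - 1) * b k * x powr (1 - p)))"
    using b p by (intro sum_ennreal) auto
  also have "(\<Sum>k = 1..n. 2 * (p / (p - 1) * b k * x powr (1 - p))) = 2 * p / (p - 1) * b' * x powr (1 - p)"
    by (simp add: b'_def sum_distrib_left sum_distrib_right sum_divide_distrib mult_ac)
  finally have SV_le: "(\<integral>\<^sup>+\<omega>. ennreal \<bar>SV \<omega>\<bar> \<partial>M) \<le> ennreal (2 * p / (p - 1) * b' * x powr (1 - p))" .
  have SV_int: "integrable M (\<lambda>\<omega>. \<bar>SV \<omega>\<bar>)"
    by (rule integrableI_bounded) (use SV_le in \<open>auto simp: le_less_trans[OF _ ennreal_less_top]\<close>)
  have "prob {\<omega> \<in> space M. \<bar>SV \<omega>\<bar> \<ge> x / 2} \<le> (\<integral>\<omega>. \<bar>SV \<omega>\<bar> \<partial>M) / (x / 2)"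
    using x SV_int by (intro integral_Markov_inequality_measure[where A = "space M"]) auto
  also have "\<dots> \<le> (2 * p / (p - 1) * b' * x powr (1 - p)) / (x / 2)"
    using x SV_le b'0 p by (intro divide_right_mono integral_real_bounded) auto
  also have "\<dots> = 4 * p / (p - 1) * b' / x powr p"
    using x p by (simp add: powr_diff field_simps)
  finally have SV_tail: "prob {\<omega> \<in> space M. \<bar>SV \<omega>\<bar> \<ge> x / 2} \<le> 4 * p / (p - 1) * b' / x powr p" .
  have "{\<omega> \<in> space M. \<bar>\<Sum>k = 1..n. d k \<omega>\<bar> \<ge> x}
      \<subseteq> {\<omega> \<in> space M. (SU \<omega>)\<^sup>2 \<ge> (x / 2)\<^sup>2} \<union> {\<omega> \<in> space M. \<bar>SV \<omega>\<bar> \<ge> x / 2}"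
  proof
    fix \<omega> assume \<omega>: "\<omega> \<in> {\<omega> \<in> space M. \<bar>\<Sum>k = 1..n. d k \<omega>\<bar> \<ge> x}"
    have "(\<Sum>k = 1..n. d k \<omega>) = SU \<omega> + SV \<omega>"
      by (simp add: SU_def SV_def U_def V_def d2_def sum.distrib[symmetric])
    then have "\<bar>SU \<omega>\<bar> \<ge> x / 2 \<or> \<bar>SV \<omega>\<bar> \<ge> x / 2" using \<omega> by auto
    then show "\<omega> \<in> {\<omega> \<in> space M. (SU \<omega>)\<^sup>2 \<ge> (x / 2)\<^sup>2} \<union> {\<omega> \<in> space M. \<bar>SV \<omega>\<bar> \<ge> x / 2}"
      using \<omega> x abs_le_square_iff[of "x / 2" "SU \<omega>"] by auto
  qed
  then have "prob {\<omega> \<in> space M. \<bar>\<Sum>k = 1..n. d k \<omega>\<bar> \<ge> x}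
      \<le> prob ({\<omega> \<in> space M. (SU \<omega>)\<^sup>2 \<ge> (x / 2)\<^sup>2} \<union> {\<omega> \<in> space M. \<bar>SV \<omega>\<bar> \<ge> x / 2})"
    by (intro finite_measure_mono) auto
  also have "\<dots> \<le> prob {\<omega> \<in> space M. (SU \<omega>)\<^sup>2 \<ge> (x / 2)\<^sup>2} + prob {\<omega> \<in> space M. \<bar>SV \<omega>\<bar> \<ge> x / 2}"
    by (intro measure_Un_le) auto
  also have "\<dots> \<le> 8 / (2 - p) * b' / x powr p + 4 * p / (p - 1) * b' / x powr p"
    by (intro add_mono SU_tail SV_tail)
  also have "\<dots> = C_const p * b' / x powr p"
    by (simp add: C_const_def add_divide_distrib distrib_right)
  finally show ?thesis unfolding b'_def .
qed

section \<open>The recursion, and independence of past and innovation\<close>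

abbreviation seq_algebra :: "(nat \<Rightarrow> 'x::topological_space) measure" where
  "seq_algebra \<equiv> Pi\<^sub>M UNIV (\<lambda>_. borel)"

locale past_recursion = prob_space M
  for M :: "'w measure" +
  fixes \<epsilon> :: "nat \<Rightarrow> 'w \<Rightarrow> 'y::polish_space"
    and F :: "nat \<Rightarrow> (nat \<Rightarrow> 'x::polish_space) \<times> 'y \<Rightarrow> 'x"
    and X :: "int \<Rightarrow> 'w \<Rightarrow> 'x"
    and x0 :: "int \<Rightarrow> 'x"
  assumes indep: "indep_vars (\<lambda>_. borel) \<epsilon> {1..}"
    and F_meas: "m \<ge> 1 \<Longrightarrow> F m \<in> seq_algebra \<Otimes>\<^sub>M borel \<rightarrow>\<^sub>M borel"
    and X_init: "j \<le> 0 \<Longrightarrow> \<omega> \<in> space M \<Longrightarrow> X j \<omega> = x0 j"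
    and X_rec: "m \<ge> 1 \<Longrightarrow> \<omega> \<in> space M \<Longrightarrow> X (int m) \<omega> = F m (past X m \<omega>, \<epsilon> m \<omega>)"
begin

abbreviation law :: "nat \<Rightarrow> 'y measure" where
  "law k \<equiv> distr M borel (\<epsilon> k)"

text \<open>The admissible pasts of time \<open>k + 1\<close>: position \<open>i\<close> stands for
  time \<open>k - i\<close>, so positions below \<open>k\<close> are free and all others carry the
  given initial values. Two members differ in at most \<open>k\<close> coordinates.\<close>

definition tail_fixed :: "nat \<Rightarrow> (nat \<Rightarrow> 'x) set" where
  "tail_fixed k = {s. \<forall>i\<ge>k. s i = x0 (int k - int i)}"

lemma eps_meas: "k \<ge> 1 \<Longrightarrow> \<epsilon> k \<in> borel_measurable M"
  using indep by (auto simp: indep_vars_def)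

lemma prob_space_law: "k \<ge> 1 \<Longrightarrow> prob_space (law k)"
  by (intro prob_space_distr eps_meas)

lemma past_Suc:
  assumes "m \<ge> 1" "\<omega> \<in> space M"
  shows "past X (Suc m) \<omega> = case_nat (F m (past X m \<omega>, \<epsilon> m \<omega>)) (past X m \<omega>)"
proof
  fix i show "past X (Suc m) \<omega> i = case_nat (F m (past X m \<omega>, \<epsilon> m \<omega>)) (past X m \<omega>) i"
    using X_rec[OF assms] by (cases i) (simp_all add: past_def algebra_simps)
qed

lemma past_tail_fixed: "\<omega> \<in> space M \<Longrightarrow> past X (Suc m) \<omega> \<in> tail_fixed m"
  by (auto simp: tail_fixed_def past_def X_init)

lemma past_one: "\<omega> \<in> space M \<Longrightarrow> past X 1 \<omega> = (\<lambda>i. x0 (- int i))"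
  by (auto simp: past_def X_init)

lemma case_nat_tail_fixed: "s \<in> tail_fixed k \<Longrightarrow> case_nat z s \<in> tail_fixed (Suc k)"
  by (auto simp: tail_fixed_def split: nat.split)

text \<open>The past as a function of the innovations alone, which makes it independent of the next one.\<close>

primrec driven_past :: "nat \<Rightarrow> (nat \<Rightarrow> 'y) \<Rightarrow> nat \<Rightarrow> 'x" where
  "driven_past 0 e = (\<lambda>i. x0 (- int i))"
| "driven_past (Suc k) e = case_nat (F (Suc k) (driven_past k e, e (Suc k))) (driven_past k e)"

text \<open>The index set \<open>J\<close> is arbitrary because the induction step needs
  \<open>driven_past k\<close> to be measurable on a product that also contains the coordinate
  \<open>Suc k\<close>.\<close>

lemma driven_past_meas:
  "{1..k} \<subseteq> J \<Longrightarrow> driven_past k \<in> Pi\<^sub>M J (\<lambda>_. borel) \<rightarrow>\<^sub>M seq_algebra"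
proof (induction k)
  case 0
  have "(\<lambda>_ i. x0 (- int i)) \<in> Pi\<^sub>M J (\<lambda>_. borel :: 'y measure) \<rightarrow>\<^sub>M seq_algebra"
    by (intro measurable_const) (simp add: space_PiM)
  then show ?case by (simp cong: measurable_cong)
next
  case (Suc k)
  have [measurable]: "driven_past k \<in> Pi\<^sub>M J (\<lambda>_. borel) \<rightarrow>\<^sub>M seq_algebra"
    by (rule Suc.IH[OF order_trans[OF _ Suc.prems]]) auto
  have [measurable]: "(\<lambda>e. e (Suc k)) \<in> Pi\<^sub>M J (\<lambda>_. borel :: 'y measure) \<rightarrow>\<^sub>M borel"
    by (rule measurable_component_singleton) (use Suc in auto)
  note F_meas[of "Suc k", simplified, measurable]
  show ?case unfolding driven_past.simps by measurable
qed

lemma past_driven_past: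
  "\<omega> \<in> space M \<Longrightarrow> (\<And>i. i \<in> {1..k} \<Longrightarrow> e i = \<epsilon> i \<omega>) \<Longrightarrow> past X (Suc k) \<omega> = driven_past k e"
proof (induction k)
  case 0
  then show ?case using past_one by simp
next
  case (Suc k)
  then show ?case using past_Suc[of "Suc k" \<omega>] by simp
qed

text \<open>Measurability of the process is derived here: on \<open>space M\<close> the past is a
  measurable function of finitely many innovations.\<close>

lemma past_meas:
  assumes "k \<ge> 1"
  shows "past X k \<in> M \<rightarrow>\<^sub>M seq_algebra"
proof -
  obtain m where m: "k = Suc m" using assms by (cases k) auto
  have "(\<lambda>\<omega>. \<lambda>i\<in>{1..m}. \<epsilon> i \<omega>) \<in> M \<rightarrow>\<^sub>M Pi\<^sub>M {1..m} (\<lambda>_. borel)"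
    by (intro measurable_restrict eps_meas) auto
  then have "(\<lambda>\<omega>. driven_past m (\<lambda>i\<in>{1..m}. \<epsilon> i \<omega>)) \<in> M \<rightarrow>\<^sub>M seq_algebra"
    using driven_past_meas[OF order_refl] by (rule measurable_compose)
  then show ?thesis
    unfolding m by (rule measurable_cong[THEN iffD1, rotated]) (rule past_driven_past[symmetric], auto)
qed

text \<open>The past of time \<open>k\<close> is a function of the innovations before
  \<open>k\<close>, and this block is independent of the block \<open>{k}\<close>. Mapping both
  blocks forward keeps the product form of the joint law.\<close>

lemma distr_past_eps:
  assumes k: "k \<ge> 1"
  shows "distr M (seq_algebra \<Otimes>\<^sub>M borel) (\<lambda>\<omega>. (past X k \<omega>, \<epsilon> k \<omega>)) = distr M seq_algebra (past X k) \<Otimes>\<^sub>M law k"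
proof -
  obtain m where m: "k = Suc m" using k by (cases k) auto
  let ?P = "Pi\<^sub>M {1..m} (\<lambda>_. borel :: 'y measure)" and ?Q = "Pi\<^sub>M {k} (\<lambda>_. borel :: 'y measure)"
  define p where "p = (\<lambda>\<omega>. \<lambda>i\<in>{1..m}. \<epsilon> i \<omega>)"
  define q where "q = (\<lambda>\<omega>. \<lambda>i\<in>{k}. \<epsilon> i \<omega>)"
  have "indep_var ?P p ?Q q"
    unfolding p_def q_def by (intro indep_var_restrict[OF indep]) (auto simp: m)
  then have pq: "distr M ?P p \<Otimes>\<^sub>M distr M ?Q q = distr M (?P \<Otimes>\<^sub>M ?Q) (\<lambda>\<omega>. (p \<omega>, q \<omega>))"
    and [measurable]: "p \<in> M \<rightarrow>\<^sub>M ?P" "q \<in> M \<rightarrow>\<^sub>M ?Q"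
    by (simp_all add: indep_var_distribution_eq)
  have [measurable]: "driven_past m \<in> ?P \<rightarrow>\<^sub>M seq_algebra" by (rule driven_past_meas) simp
  have [measurable]: "(\<lambda>e. e k) \<in> ?Q \<rightarrow>\<^sub>M borel" by (rule measurable_component_singleton) simp
  have p_past: "past X k \<omega> = driven_past m (p \<omega>)" if "\<omega> \<in> space M" for \<omega>
    unfolding m using that by (rule past_driven_past) (simp add: p_def)
  have q_eps: "\<epsilon> k \<omega> = q \<omega> k" for \<omega> by (simp add: q_def)
  have past: "distr M seq_algebra (past X k) = distr (distr M ?P p) seq_algebra (driven_past m)"
    by (subst distr_distr) (auto simp: p_past simp del: One_nat_def intro!: distr_cong)
  have law: "law k = distr (distr M ?Q q) borel (\<lambda>e. e k)"
    by (subst distr_distr) (auto simp: q_eps intro!: distr_cong)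
  have "sigma_finite_measure (distr (distr M ?Q q) borel (\<lambda>e. e k))"
    using prob_space_law[OF k] unfolding law by (simp add: prob_space_imp_sigma_finite)
  then have "distr M seq_algebra (past X k) \<Otimes>\<^sub>M law k
      = distr (distr M ?P p \<Otimes>\<^sub>M distr M ?Q q) (seq_algebra \<Otimes>\<^sub>M borel) (\<lambda>(x, y). (driven_past m x, y k))"
    unfolding past law by (intro pair_measure_distr) (auto simp del: One_nat_def)
  also have "\<dots> = distr M (seq_algebra \<Otimes>\<^sub>M borel) (\<lambda>\<omega>. (past X k \<omega>, \<epsilon> k \<omega>))"
    unfolding pq by (subst distr_distr) (auto simp: p_past q_eps simp del: One_nat_def intro!: distr_cong)
  finally show ?thesis by simp
qed

text \<open>The next innovation can be averaged with the past frozen. This replaces regular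
  conditional distributions throughout.\<close>

lemma nn_integral_past_eps:
  assumes k: "k \<ge> 1" and h: "h \<in> borel_measurable (seq_algebra \<Otimes>\<^sub>M borel)"
  shows "(\<integral>\<^sup>+\<omega>. h (past X k \<omega>, \<epsilon> k \<omega>) \<partial>M) = (\<integral>\<^sup>+\<omega>. (\<integral>\<^sup>+y. h (past X k \<omega>, y) \<partial>law k) \<partial>M)"
proof -
  note [measurable] = past_meas[OF k] eps_meas[OF k] h
  interpret L: prob_space "law k" by (rule prob_space_law[OF k])
  have h': "h \<in> borel_measurable (distr M seq_algebra (past X k) \<Otimes>\<^sub>M law k)"
    using h by (simp cong: measurable_cong_sets)
  have "(\<integral>\<^sup>+\<omega>. h (past X k \<omega>, \<epsilon> k \<omega>) \<partial>M) = (\<integral>\<^sup>+z. h z \<partial>(distr M seq_algebra (past X k) \<Otimes>\<^sub>M law k))"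
    unfolding distr_past_eps[OF k, symmetric] by (subst nn_integral_distr) auto
  also have "\<dots> = (\<integral>\<^sup>+s. (\<integral>\<^sup>+y. h (s, y) \<partial>law k) \<partial>distr M seq_algebra (past X k))"
    by (rule L.nn_integral_fst[OF h', symmetric])
  also have "\<dots> = (\<integral>\<^sup>+\<omega>. (\<integral>\<^sup>+y. h (past X k \<omega>, y) \<partial>law k) \<partial>M)"
    by (subst nn_integral_distr) auto
  finally show ?thesis .
qed

lemma integral_past_eps:
  fixes h :: "_ \<Rightarrow> real"
  assumes k: "k \<ge> 1" and h: "h \<in> borel_measurable (seq_algebra \<Otimes>\<^sub>M borel)"
    and int: "integrable M (\<lambda>\<omega>. h (past X k \<omega>, \<epsilon> k \<omega>))"
  shows "(\<integral>\<omega>. h (past X k \<omega>, \<epsilon> k \<omega>) \<partial>M) = (\<integral>\<omega>. (\<integral>y. h (past X k \<omega>, y) \<partial>law k) \<partial>M)"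
proof -
  note [measurable] = past_meas[OF k] eps_meas[OF k] h
  interpret L: prob_space "law k" by (rule prob_space_law[OF k])
  interpret S: prob_space "distr M seq_algebra (past X k)" by (rule prob_space_distr) simp
  interpret P: pair_sigma_finite "distr M seq_algebra (past X k)" "law k" ..
  have "integrable (distr M seq_algebra (past X k) \<Otimes>\<^sub>M law k) h"
    unfolding distr_past_eps[OF k, symmetric] using int by (subst integrable_distr_eq) auto
  then have "(\<integral>z. h z \<partial>(distr M seq_algebra (past X k) \<Otimes>\<^sub>M law k)) = (\<integral>s. (\<integral>y. h (s, y) \<partial>law k) \<partial>distr M seq_algebra (past X k))"
    by (rule P.integral_fst'[symmetric])
  moreover have "(\<integral>z. h z \<partial>(distr M seq_algebra (past X k) \<Otimes>\<^sub>M law k)) = (\<integral>\<omega>. h (past X k \<omega>, \<epsilon> k \<omega>) \<partial>M)"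
    unfolding distr_past_eps[OF k, symmetric] by (subst integral_distr) auto
  moreover have "(\<integral>s. (\<integral>y. h (s, y) \<partial>law k) \<partial>distr M seq_algebra (past X k)) = (\<integral>\<omega>. (\<integral>y. h (past X k \<omega>, y) \<partial>law k) \<partial>M)"
    by (subst integral_distr) auto
  ultimately show ?thesis by simp
qed

end

section \<open>The Lipschitz coefficients\<close>

text \<open>
  \<open>lip_coeff a m i\<close> is the Lipschitz constant in the coordinate at time \<open>n - m - i\<close> of the conditional
  expectation of \<open>f\<close> given the values up to time \<open>n - m\<close>.
\<close>

definition lip_coeff :: "(nat \<Rightarrow> real) \<Rightarrow> nat \<Rightarrow> nat \<Rightarrow> real" where
  "lip_coeff a m i = 1 + (\<Sum>l<m. diag_coeff a l * a (m - l + i))"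

lemma lip_coeff_0: "lip_coeff a 0 i = 1"
  by (simp add: lip_coeff_def)

text \<open>The recursion for \<open>diag_coeff\<close> is the case \<open>i = 0\<close> with the
  term \<open>l = 0\<close>, which is \<open>a m\<close>, split off.\<close>

lemma lip_coeff_diag: "lip_coeff a m 0 = diag_coeff a m"
proof (cases m)
  case (Suc k)
  have "{..<Suc k} = insert 0 {1..k}" by auto
  then show ?thesis by (simp add: Suc lip_coeff_def)
qed (simp add: lip_coeff_def)

text \<open>This mirrors integrating out the newest coordinate. Its constant
  \<open>diag_coeff a m\<close> is spread over the older coordinates with the contraction weights,
  while coordinate \<open>Suc i\<close> moves to position \<open>i\<close> and keeps its own
  constant.\<close>

lemma lip_coeff_Suc: "lip_coeff a (Suc m) i = lip_coeff a m (Suc i) + diag_coeff a m * a (Suc i)"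
proof -
  have "(\<Sum>l<m. diag_coeff a l * a (Suc m - l + i)) = (\<Sum>l<m. diag_coeff a l * a (m - l + Suc i))"
    by (intro sum.cong) (auto simp: Suc_diff_le)
  then show ?thesis by (simp add: lip_coeff_def)
qed

text \<open>Strict positivity is what matters later: tail levels are divided by this number.\<close>

lemma diag_coeff_ge_1:
  assumes "\<And>i. i \<ge> 1 \<Longrightarrow> a i \<ge> 0"
  shows "diag_coeff a k \<ge> 1"
proof (induction k rule: less_induct)
  case (less k)
  show ?case
  proof (cases k)
    case (Suc j)
    have "(\<Sum>l = 1..j. diag_coeff a l * a (Suc j - l)) \<ge> 0"
      using less Suc assms by (intro sum_nonneg mult_nonneg_nonneg) (force intro: order_trans[OF zero_le_one])+
    then show ?thesis using assms Suc by simp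
  qed simp
qed

section \<open>Weak moments of variables that may be infinite\<close>

lemma weak_moment_tail:
  assumes "weak_moment M p (\<lambda>\<omega>. enn2ereal (h \<omega>)) \<le> ereal A" and "t > 0"
  shows "measure M {\<omega> \<in> space M. h \<omega> > ennreal t} \<le> A / t powr p"
proof -
  have "\<bar>enn2ereal c\<bar> > ereal t \<longleftrightarrow> c > ennreal t" for c
    using \<open>t > 0\<close> by (simp add: less_ennreal.rep_eq)
  then have "ereal (t powr p * measure M {\<omega> \<in> space M. h \<omega> > ennreal t})
      \<le> weak_moment M p (\<lambda>\<omega>. enn2ereal (h \<omega>))"
    unfolding weak_moment_def using \<open>t > 0\<close> by (intro SUP_upper2[of t]) auto
  also note assms(1)
  finally show ?thesis using \<open>t > 0\<close> by (simp add: field_simps)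
qed

text \<open>The tail bound at arbitrarily high levels forces \<open>h\<close> to be finite almost
  surely, which reduces the claim to the real-valued case.\<close>

lemma (in prob_space) nn_integral_finite_weak_tail:
  fixes h :: "'a \<Rightarrow> ennreal"
  assumes [measurable]: "h \<in> borel_measurable M"
    and tail: "\<And>t. t > 0 \<Longrightarrow> prob {\<omega> \<in> space M. h \<omega> > ennreal t} \<le> B / t powr p"
    and p: "1 < p"
  shows "(\<integral>\<^sup>+\<omega>. h \<omega> \<partial>M) < \<infinity>"
proof -
  have B: "B \<ge> 0" using order_trans[OF measure_nonneg tail[of 1]] by simp
  have "prob {\<omega> \<in> space M. h \<omega> = \<infinity>} \<le> 0 + e" if "e > 0" for e
  proof -
    \<comment> \<open>Chosen so that \<open>t powr p\<close> is \<open>B / e + 1\<close>, hence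
      \<open>B / t powr p\<close> is at most \<open>e\<close>; the summand 1 keeps \<open>t\<close>
      positive when \<open>B = 0\<close>.\<close>
    define t where "t = (B / e + 1) powr (1 / p)"
    have pos: "B / e + 1 > 0" using B \<open>e > 0\<close> by (simp add: add_nonneg_pos)
    then have t: "t > 0" "t powr p = B / e + 1" using p by (simp_all add: t_def powr_powr)
    have "prob {\<omega> \<in> space M. h \<omega> = \<infinity>} \<le> prob {\<omega> \<in> space M. h \<omega> > ennreal t}"
      by (intro finite_measure_mono) auto
    also have "\<dots> \<le> B / (B / e + 1)" using tail[OF t(1)] t(2) by simp
    also have "\<dots> \<le> e" using pos \<open>e > 0\<close> by (simp add: field_simps)
    finally show ?thesis by simp
  qed
  then have "prob {\<omega> \<in> space M. h \<omega> = \<infinity>} \<le> 0" by (rule field_le_epsilon)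
  then have "AE \<omega> in M. \<not> h \<omega> = \<infinity>"
    by (subst AE_iff_measurable[of "{\<omega> \<in> space M. h \<omega> = \<infinity>}"])
       (auto simp: emeasure_eq_measure measure_le_0_iff)
  then have fin: "AE \<omega> in M. h \<omega> = ennreal (enn2real (h \<omega>))" by (auto elim!: eventually_mono simp: less_top)
  have "integrable M (\<lambda>\<omega>. enn2real (h \<omega>))"
  proof (rule integrable_weak_tail)
    fix t :: real assume t: "t > 0"
    have "prob {\<omega> \<in> space M. \<bar>enn2real (h \<omega>)\<bar> > t} \<le> prob {\<omega> \<in> space M. h \<omega> > ennreal t}"
    proof (intro finite_measure_mono subsetI)
      fix \<omega> assume "\<omega> \<in> {\<omega> \<in> space M. \<bar>enn2real (h \<omega>)\<bar> > t}"
      then show "\<omega> \<in> {\<omega> \<in> space M. h \<omega> > ennreal t}"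
        using t by (cases "h \<omega>") (auto simp: ennreal_less_iff)
    qed simp
    then show "prob {\<omega> \<in> space M. \<bar>enn2real (h \<omega>)\<bar> > t} \<le> B / t powr p"
      using tail[OF t] by linarith
  qed (use p B in auto)
  then have "(\<integral>\<^sup>+\<omega>. ennreal (enn2real (h \<omega>)) \<partial>M) < \<infinity>"
    by (simp add: integrable_iff_bounded)
  then show ?thesis using nn_integral_cong_AE[OF fin] by simp
qed

lemma H_dist_measurable:
  fixes G :: "(nat \<Rightarrow> 'x::polish_space) \<times> 'y::polish_space \<Rightarrow> 'x"
  assumes [measurable]: "G \<in> seq_algebra \<Otimes>\<^sub>M borel \<rightarrow>\<^sub>M borel"
    and P: "prob_space P" and sets_P [measurable_cong]: "sets P = sets borel"
  shows "(\<lambda>(s, z). H_dist G P s z) \<in> borel_measurable (seq_algebra \<Otimes>\<^sub>M borel)"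
proof -
  interpret prob_space P by fact
  show ?thesis unfolding H_dist_def by measurable
qed

lemma (in prob_space) AE_obtains:
  assumes "AE \<omega> in M. Q \<omega>"
  obtains \<omega> where "\<omega> \<in> space M" "Q \<omega>"
proof -
  have "\<not> (AE \<omega> in M. False)" by (simp add: AE_False)
  moreover have "AE \<omega> in M. False" if "\<And>\<omega>. \<omega> \<in> space M \<Longrightarrow> \<not> Q \<omega>"
    using assms AE_space by eventually_elim (use that in auto)
  ultimately show ?thesis using that by blast
qed

section \<open>Integrability from contraction and weak moments\<close>

locale contractive_recursion = past_recursion M \<epsilon> F X x0
  for M :: "'w measure"
    and \<epsilon> :: "nat \<Rightarrow> 'w \<Rightarrow> 'y::polish_space"
    and F :: "nat \<Rightarrow> (nat \<Rightarrow> 'x::polish_space) \<times> 'y \<Rightarrow> 'x"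
    and X :: "int \<Rightarrow> 'w \<Rightarrow> 'x"
    and x0 :: "int \<Rightarrow> 'x" +
  fixes a A :: "nat \<Rightarrow> real" and n :: nat and f :: "(nat \<Rightarrow> 'x) \<Rightarrow> real" and p :: real
  assumes a_nonneg: "i \<ge> 1 \<Longrightarrow> a i \<ge> 0"
    and contraction: "m \<ge> 1 \<Longrightarrow>
      (\<integral>\<^sup>+\<omega>. ennreal (dist (F m (s, \<epsilon> m \<omega>)) (F m (s', \<epsilon> m \<omega>))) \<partial>M) \<le> (\<Sum>i. ennreal (a (Suc i) * dist (s i) (s' i)))"
    and f_lip: "u \<in> {1..n} \<rightarrow>\<^sub>E UNIV \<Longrightarrow> v \<in> {1..n} \<rightarrow>\<^sub>E UNIV \<Longrightarrow> \<bar>f u - f v\<bar> \<le> (\<Sum>i = 1..n. dist (u i) (v i))"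
    and p: "1 < p" "p < 2"
    and weak: "k \<in> {1..n} \<Longrightarrow>
      weak_moment M p (\<lambda>\<omega>. enn2ereal (H_dist (F k) (law k) (past X k \<omega>) (\<epsilon> k \<omega>))) \<le> ereal (A k)"
begin

lemma H_meas: "k \<ge> 1 \<Longrightarrow> (\<lambda>(s, z). H_dist (F k) (law k) s z) \<in> borel_measurable (seq_algebra \<Otimes>\<^sub>M borel)"
  by (intro H_dist_measurable F_meas prob_space_law) auto

lemma H_past_meas: "k \<ge> 1 \<Longrightarrow> (\<lambda>\<omega>. H_dist (F k) (law k) (past X k \<omega>) (\<epsilon> k \<omega>)) \<in> borel_measurable M"
  using measurable_compose[OF measurable_Pair[OF past_meas eps_meas] H_meas, of k] by simp

lemma F_section_meas [measurable (raw)]: "k \<ge> 1 \<Longrightarrow> (\<lambda>y. F k (s, y)) \<in> borel_measurable (law k)"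
  using measurable_compose[OF measurable_Pair1' F_meas, of s k] by (simp add: space_PiM)

text \<open>Both pasts carry the same values from position \<open>k - 1\<close> on, so the
  contraction series reduces to a finite sum and the bound is a real number.\<close>

lemma contraction_tail_fixed:
  assumes k: "k \<ge> 1" and s: "s \<in> tail_fixed (k - 1)" "s' \<in> tail_fixed (k - 1)"
  shows "(\<integral>\<^sup>+y. ennreal (dist (F k (s, y)) (F k (s', y))) \<partial>law k)
    \<le> ennreal (\<Sum>i<k - 1. a (Suc i) * dist (s i) (s' i))"
proof -
  note [measurable] = eps_meas[OF k]
  have "(\<integral>\<^sup>+y. ennreal (dist (F k (s, y)) (F k (s', y))) \<partial>law k)
      = (\<integral>\<^sup>+\<omega>. ennreal (dist (F k (s, \<epsilon> k \<omega>)) (F k (s', \<epsilon> k \<omega>))) \<partial>M)"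
    using F_section_meas[OF k, of s] F_section_meas[OF k, of s'] by (subst nn_integral_distr) auto
  also have "\<dots> \<le> (\<Sum>i. ennreal (a (Suc i) * dist (s i) (s' i)))"
    by (rule contraction[OF k])
  also have "\<dots> = (\<Sum>i<k - 1. ennreal (a (Suc i) * dist (s i) (s' i)))"
    using s by (intro suminf_finite) (auto simp: tail_fixed_def)
  also have "\<dots> = ennreal (\<Sum>i<k - 1. a (Suc i) * dist (s i) (s' i))"
    by (intro sum_ennreal) (auto simp: a_nonneg)
  finally show ?thesis .
qed

lemma integrable_dist_sections:
  assumes k: "k \<ge> 1" and s: "s \<in> tail_fixed (k - 1)" "s' \<in> tail_fixed (k - 1)"
  shows "integrable (law k) (\<lambda>y. dist (F k (s, y)) (F k (s', y)))"
    and "(\<integral>y. dist (F k (s, y)) (F k (s', y)) \<partial>law k) \<le> (\<Sum>i<k - 1. a (Suc i) * dist (s i) (s' i))"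
proof -
  have "(\<integral>\<^sup>+y. ennreal (norm (dist (F k (s, y)) (F k (s', y)))) \<partial>law k) < \<infinity>"
    using contraction_tail_fixed[OF assms] by (simp add: le_less_trans[OF _ ennreal_less_top])
  then show "integrable (law k) (\<lambda>y. dist (F k (s, y)) (F k (s', y)))"
    using F_section_meas[OF k] by (intro integrableI_bounded borel_measurable_dist) auto
  show "(\<integral>y. dist (F k (s, y)) (F k (s', y)) \<partial>law k) \<le> (\<Sum>i<k - 1. a (Suc i) * dist (s i) (s' i))"
    using contraction_tail_fixed[OF assms] by (intro integral_real_bounded sum_nonneg) (auto simp: a_nonneg)
qed

lemma past_tail_fixed': "k \<ge> 1 \<Longrightarrow> \<omega> \<in> space M \<Longrightarrow> past X k \<omega> \<in> tail_fixed (k - 1)"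
  using past_tail_fixed[of \<omega> "k - 1"] by simp

text \<open>
  The weak moment of \<open>H\<^sub>k\<close> gives integrability for some past \<open>s0\<close> with the prescribed values at
  times \<open>\<le> 0\<close>; the contraction carries it over to all of them, since only finitely many coordinates
  differ.
\<close>

lemma integrable_dist_section:
  assumes k: "k \<in> {1..n}" and s: "s \<in> tail_fixed (k - 1)"
  shows "integrable (law k) (\<lambda>y. dist z (F k (s, y)))"
proof -
  have k1: "k \<ge> 1" using k by simp
  interpret L: prob_space "law k" by (rule prob_space_law[OF k1])
  \<comment> \<open>\<open>H_dist\<close> along the process has finite mean because
    \<open>p > 1\<close>. Freezing the past shows that its average over the innovation is finite for
    almost every past, so a suitable one can be picked.\<close>
  have "(\<integral>\<^sup>+\<omega>. (\<integral>\<^sup>+y. H_dist (F k) (law k) (past X k \<omega>) y \<partial>law k) \<partial>M)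
      = (\<integral>\<^sup>+\<omega>. H_dist (F k) (law k) (past X k \<omega>) (\<epsilon> k \<omega>) \<partial>M)"
    using nn_integral_past_eps[OF k1 H_meas[OF k1]] by simp
  also have "\<dots> < \<infinity>"
    by (rule nn_integral_finite_weak_tail[OF H_past_meas[OF k1] weak_moment_tail[OF weak[OF k]] p(1)])
  finally have "AE \<omega> in M. (\<integral>\<^sup>+y. H_dist (F k) (law k) (past X k \<omega>) y \<partial>law k) \<noteq> \<infinity>"
    using L.borel_measurable_nn_integral[of "H_dist (F k) (law k)" seq_algebra] H_meas[OF k1] past_meas[OF k1]
    by (intro nn_integral_PInf_AE measurable_compose[OF past_meas[OF k1]]) auto
  then obtain \<omega> where \<omega>: "\<omega> \<in> space M" "(\<integral>\<^sup>+y. H_dist (F k) (law k) (past X k \<omega>) y \<partial>law k) \<noteq> \<infinity>"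
    by (rule AE_obtains)
  define s0 where "s0 = past X k \<omega>"
  have s0: "s0 \<in> tail_fixed (k - 1)" unfolding s0_def using k1 \<omega>(1) by (rule past_tail_fixed')
  have "AE y in law k. H_dist (F k) (law k) s0 y \<noteq> \<infinity>"
    using \<omega>(2) measurable_compose[OF measurable_Pair1' H_meas[OF k1], of s0] unfolding s0_def
    by (intro nn_integral_PInf_AE) (auto simp: space_PiM)
  \<comment> \<open>Finiteness of \<open>H_dist\<close> at \<open>y0\<close> is precisely
    integrability of the distance from the fixed point \<open>F k (s0, y0)\<close>.\<close>
  then obtain y0 where y0: "H_dist (F k) (law k) s0 y0 \<noteq> \<infinity>"
    by (rule L.AE_obtains)
  have "integrable (law k) (\<lambda>y. dist (F k (s0, y0)) (F k (s0, y)))"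
    using y0 F_section_meas[OF k1]
    by (intro integrableI_bounded borel_measurable_dist) (auto simp: H_dist_def less_top)
  then have "integrable (law k) (\<lambda>y. dist z (F k (s0, y0)) + dist (F k (s0, y0)) (F k (s0, y)) + dist (F k (s0, y)) (F k (s, y)))"
    using integrable_dist_sections(1)[OF k1 s0 s] by simp
  then show ?thesis
  proof (rule Bochner_Integration.integrable_bound)
    show "(\<lambda>y. dist z (F k (s, y))) \<in> borel_measurable (law k)"
      using F_section_meas[OF k1] by (intro borel_measurable_dist) auto
    show "AE y in law k. norm (dist z (F k (s, y)))
        \<le> norm (dist z (F k (s0, y0)) + dist (F k (s0, y0)) (F k (s0, y)) + dist (F k (s0, y)) (F k (s, y)))"
    proof (intro AE_I2)
      fix y
      show "norm (dist z (F k (s, y)))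
          \<le> norm (dist z (F k (s0, y0)) + dist (F k (s0, y0)) (F k (s0, y)) + dist (F k (s0, y)) (F k (s, y)))"
        using dist_triangle[of z "F k (s, y)" "F k (s0, y)"] dist_triangle[of z "F k (s0, y)" "F k (s0, y0)"]
        by simp
    qed
  qed
qed

lemma diag_ge_1: "diag_coeff a k \<ge> 1"
  by (rule diag_coeff_ge_1) (rule a_nonneg)

section \<open>Conditional values and their Lipschitz bounds\<close>

text \<open>
  \<open>cond_value m s\<close> is the conditional expectation of \<open>f (X\<^sub>1, \<dots>, X\<^sub>n)\<close> given that \<open>s\<close> is the
  past of time \<open>n - m + 1\<close>; it is only meaningful for \<open>m \<le> n\<close>.
\<close>

primrec cond_value :: "nat \<Rightarrow> (nat \<Rightarrow> 'x) \<Rightarrow> real" where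
  "cond_value 0 s = f (\<lambda>i\<in>{1..n}. s (n - i))"
| "cond_value (Suc m) s = (\<integral>y. cond_value m (case_nat (F (n - m) (s, y)) s) \<partial>law (n - m))"

lemma cond_value_0_lipschitz: "\<bar>cond_value 0 s - cond_value 0 s'\<bar> \<le> (\<Sum>i<n. dist (s i) (s' i))"
proof -
  have "\<bar>cond_value 0 s - cond_value 0 s'\<bar> \<le> (\<Sum>i = 1..n. dist ((\<lambda>i\<in>{1..n}. s (n - i)) i) ((\<lambda>i\<in>{1..n}. s' (n - i)) i))"
    unfolding cond_value.simps by (intro f_lip) auto
  also have "\<dots> = (\<Sum>i = 1..n. dist (s (n - i)) (s' (n - i)))" by simp
  also have "\<dots> = (\<Sum>i<n. dist (s i) (s' i))"
    by (rule sum.reindex_bij_witness[where i = "\<lambda>i. n - i" and j = "\<lambda>i. n - i"]) auto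
  finally show ?thesis .
qed

text \<open>The Lipschitz condition makes the starting function continuous for the product topology,
  whose Borel sets are those of \<open>seq_algebra\<close>; this yields measurability. Later values
  are parametrised integrals of measurable functions.\<close>

lemma cond_value_meas: "m \<le> n \<Longrightarrow> cond_value m \<in> borel_measurable seq_algebra"
proof (induction m)
  case 0
  have "continuous_on UNIV (cond_value 0)"
    unfolding continuous_on_def
  proof
    fix s :: "nat \<Rightarrow> 'x"
    have "((\<lambda>s'. \<Sum>i<n. dist (s' i) (s i)) \<longlongrightarrow> (\<Sum>i<n. dist (s i) (s i))) (at s)"
      by (intro tendsto_sum tendsto_dist tendsto_const)
         (rule continuous_on_tendsto_compose[OF continuous_on_product_coordinates tendsto_ident_at], auto)
    then have "((\<lambda>s'. \<Sum>i<n. dist (s' i) (s i)) \<longlongrightarrow> 0) (at s)" by simp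
    then have "((\<lambda>s'. cond_value 0 s' - cond_value 0 s) \<longlongrightarrow> 0) (at s)"
      by (rule Lim_null_comparison[rotated]) (use cond_value_0_lipschitz in auto)
    then show "(cond_value 0 \<longlongrightarrow> cond_value 0 s) (at s)" by (rule LIM_zero_cancel)
  qed
  then have "cond_value 0 \<in> borel_measurable borel" by (rule borel_measurable_continuous_onI)
  then show ?case
    using measurable_cong_sets[OF sets_PiM_equal_borel refl] by blast
next
  case (Suc m)
  then have [measurable]: "cond_value m \<in> borel_measurable seq_algebra" by simp
  have k: "n - m \<ge> 1" using Suc.prems by simp
  note [measurable] = F_meas[OF k]
  interpret L: prob_space "law (n - m)" by (rule prob_space_law[OF k])
  show ?case unfolding cond_value.simps by measurable
qed

lemma step_meas:
  assumes k: "k \<in> {1..n}"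
  shows "(\<lambda>(s, y). cond_value (n - k) (case_nat (F k (s, y)) s)) \<in> borel_measurable (seq_algebra \<Otimes>\<^sub>M borel)"
proof -
  have [measurable]: "F k \<in> seq_algebra \<Otimes>\<^sub>M borel \<rightarrow>\<^sub>M borel" using k by (intro F_meas) simp
  have [measurable]: "cond_value (n - k) \<in> borel_measurable seq_algebra" by (rule cond_value_meas) simp
  show ?thesis by measurable
qed

lemma step_section_meas:
  assumes k: "k \<in> {1..n}"
  shows "(\<lambda>y. cond_value (n - k) (case_nat (F k (s, y)) s)) \<in> borel_measurable (law k)"
  using measurable_compose[OF measurable_Pair1' step_meas[OF k], of s] by (simp add: space_PiM)

lemma cond_value_Suc:
  "k \<in> {1..n} \<Longrightarrow> cond_value (Suc (n - k)) s = (\<integral>y. cond_value (n - k) (case_nat (F k (s, y)) s) \<partial>law k)"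
  by simp

text \<open>The constant \<open>c\<close> is left open so that the lemma can serve inside the
  induction for \<open>cond_value_lipschitz\<close>, where only the induction hypothesis is at hand,
  and again afterwards.\<close>

lemma step_integrable:
  assumes k: "k \<in> {1..n}" and s: "s \<in> tail_fixed (k - 1)"
    and lip: "\<And>z z'. \<bar>cond_value (n - k) (case_nat z s) - cond_value (n - k) (case_nat z' s)\<bar> \<le> c * dist z z'"
  shows "integrable (law k) (\<lambda>y. cond_value (n - k) (case_nat (F k (s, y)) s))"
proof -
  interpret L: prob_space "law k" using k by (intro prob_space_law) simp
  define z where "z = s 0"
  define v where "v = cond_value (n - k) (case_nat z s)"
  have "integrable (law k) (\<lambda>y. \<bar>v\<bar> + c * dist z (F k (s, y)))"
    using integrable_dist_section[OF k s] by simp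
  then show ?thesis
  proof (rule Bochner_Integration.integrable_bound[OF _ step_section_meas[OF k]])
    show "AE y in law k. norm (cond_value (n - k) (case_nat (F k (s, y)) s)) \<le> norm (\<bar>v\<bar> + c * dist z (F k (s, y)))"
    proof (intro AE_I2)
      fix y
      show "norm (cond_value (n - k) (case_nat (F k (s, y)) s)) \<le> norm (\<bar>v\<bar> + c * dist z (F k (s, y)))"
        using lip[of z "F k (s, y)"] by (simp add: v_def)
    qed
  qed
qed

lemma cond_value_lipschitz:
  assumes "m \<le> n" "s \<in> tail_fixed (n - m)" "s' \<in> tail_fixed (n - m)"
  shows "\<bar>cond_value m s - cond_value m s'\<bar> \<le> (\<Sum>i<n - m. lip_coeff a m i * dist (s i) (s' i))"
  using assms
proof (induction m arbitrary: s s')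
  case 0
  then show ?case using cond_value_0_lipschitz[of s s'] by (simp only: lip_coeff_0 mult_1 diff_zero)
next
  case (Suc m)
  define k where "k = n - m"
  define c where "c = diag_coeff a m"
  have k: "k \<in> {1..n}" "n - k = m" "n - Suc m = k - 1" and k1: "k \<ge> 1" "Suc (k - 1) = k"
    using Suc.prems(1) by (auto simp: k_def)
  have c0: "c \<ge> 0" unfolding c_def using diag_ge_1[of m] by simp
  \<comment> \<open>Position 0 holds the newest value, at time \<open>k\<close>, with constant
    \<open>lip_coeff a m 0\<close>, that is \<open>c\<close>; the older coordinates are shifted by
    one position.\<close>
  have step: "\<bar>cond_value m (case_nat z s) - cond_value m (case_nat z' s')\<bar>
      \<le> c * dist z z' + (\<Sum>i<k - 1. lip_coeff a m (Suc i) * dist (s i) (s' i))"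
    if "s \<in> tail_fixed (k - 1)" "s' \<in> tail_fixed (k - 1)" for s s' z z'
  proof -
    have "\<bar>cond_value m (case_nat z s) - cond_value m (case_nat z' s')\<bar>
        \<le> (\<Sum>i<Suc (k - 1). lip_coeff a m i * dist (case_nat z s i) (case_nat z' s' i))"
      using Suc.IH[of "case_nat z s" "case_nat z' s'", folded k_def] Suc.prems(1)
        case_nat_tail_fixed[OF that(1), of z] case_nat_tail_fixed[OF that(2), of z']
      unfolding k1(2) by simp
    then show ?thesis
      unfolding sum.lessThan_Suc_shift by (simp add: c_def lip_coeff_diag)
  qed
  note s = Suc.prems(2)[unfolded k(3)] and s' = Suc.prems(3)[unfolded k(3)]
  \<comment> \<open>Integrability is needed to merge the two conditional values into one integral,
    because the Bochner integral of a non-integrable function is 0 by default.\<close>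
  have int: "integrable (law k) (\<lambda>y. cond_value m (case_nat (F k (s, y)) s))"
    if "s \<in> tail_fixed (k - 1)" for s
    using step_integrable[OF k(1) that, of c] step[OF that that] by (simp add: k(2))
  let ?r = "\<Sum>i<k - 1. lip_coeff a m (Suc i) * dist (s i) (s' i)"
  interpret L: prob_space "law k" using k by (intro prob_space_law) simp
  have "\<bar>cond_value (Suc m) s - cond_value (Suc m) s'\<bar>
      = \<bar>\<integral>y. cond_value m (case_nat (F k (s, y)) s) - cond_value m (case_nat (F k (s', y)) s') \<partial>law k\<bar>"
    using int[OF s] int[OF s'] by (simp add: k_def)
  also have "\<dots> \<le> (\<integral>y. \<bar>cond_value m (case_nat (F k (s, y)) s) - cond_value m (case_nat (F k (s', y)) s')\<bar> \<partial>law k)"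
    by (rule integral_abs_bound)
  also have "\<dots> \<le> (\<integral>y. c * dist (F k (s, y)) (F k (s', y)) + ?r \<partial>law k)"
  proof (rule integral_mono)
    show "integrable (law k) (\<lambda>y. \<bar>cond_value m (case_nat (F k (s, y)) s) - cond_value m (case_nat (F k (s', y)) s')\<bar>)"
      by (rule integrable_abs[OF Bochner_Integration.integrable_diff[OF int[OF s] int[OF s']]])
    show "integrable (law k) (\<lambda>y. c * dist (F k (s, y)) (F k (s', y)) + ?r)"
      using integrable_dist_sections(1)[OF k1(1) s s'] by simp
  qed (rule step[OF s s'])
  also have "\<dots> = c * (\<integral>y. dist (F k (s, y)) (F k (s', y)) \<partial>law k) + ?r"
    using integrable_dist_sections(1)[OF k1(1) s s'] L.prob_space by simp
  also have "\<dots> \<le> c * (\<Sum>i<k - 1. a (Suc i) * dist (s i) (s' i)) + ?r"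
    using integrable_dist_sections(2)[OF k1(1) s s'] c0 by (intro add_right_mono mult_left_mono)
  also have "\<dots> = (\<Sum>i<k - 1. lip_coeff a (Suc m) i * dist (s i) (s' i))"
    by (simp add: lip_coeff_Suc c_def sum_distrib_left sum.distrib[symmetric] algebra_simps)
  finally show ?case by (simp add: k(3))
qed

lemma step_lipschitz:
  assumes k: "k \<in> {1..n}" and s: "s \<in> tail_fixed (k - 1)"
  shows "\<bar>cond_value (n - k) (case_nat z s) - cond_value (n - k) (case_nat z' s)\<bar> \<le> diag_coeff a (n - k) * dist z z'"
proof -
  have k1: "Suc (k - 1) = k" and nk: "n - (n - k) = k" using k by auto
  have "\<bar>cond_value (n - k) (case_nat z s) - cond_value (n - k) (case_nat z' s)\<bar>
      \<le> (\<Sum>i<Suc (k - 1). lip_coeff a (n - k) i * dist (case_nat z s i) (case_nat z' s i))"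
    using cond_value_lipschitz[of "n - k" "case_nat z s" "case_nat z' s"]
      case_nat_tail_fixed[OF s, of z] case_nat_tail_fixed[OF s, of z']
    unfolding k1 nk by simp
  then show ?thesis unfolding sum.lessThan_Suc_shift by (simp add: lip_coeff_diag)
qed

section \<open>The martingale differences\<close>

text \<open>A function of past and innovation instead of the sample point, so that the innovation
  can be averaged with the past frozen.\<close>

definition incr :: "nat \<Rightarrow> (nat \<Rightarrow> 'x) \<times> 'y \<Rightarrow> real" where
  "incr k = (\<lambda>(s, y). cond_value (n - k) (case_nat (F k (s, y)) s) - cond_value (Suc (n - k)) s)"

lemma incr_meas:
  assumes k: "k \<in> {1..n}"
  shows "incr k \<in> borel_measurable (seq_algebra \<Otimes>\<^sub>M borel)"
proof -
  have "cond_value (Suc (n - k)) \<in> borel_measurable seq_algebra"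
    by (rule cond_value_meas) (use k in auto)
  then have "(\<lambda>z. cond_value (Suc (n - k)) (fst z)) \<in> borel_measurable (seq_algebra \<Otimes>\<^sub>M borel)"
    by (rule measurable_compose[OF measurable_fst])
  from borel_measurable_diff[OF step_meas[OF k] this] show ?thesis
    unfolding incr_def case_prod_beta' .
qed

text \<open>The subtracted value is the average of the same expression over an independent copy
  \<open>y\<close> of the innovation. The increment is thus an average of differences, each at most
  \<open>c\<close> times the distance that \<open>H_dist\<close> integrates.\<close>

lemma incr_le_H_dist:
  assumes k: "k \<in> {1..n}" and s: "s \<in> tail_fixed (k - 1)"
  shows "ennreal \<bar>incr k (s, z)\<bar> \<le> ennreal (diag_coeff a (n - k)) * H_dist (F k) (law k) s z"
proof -
  let ?g = "\<lambda>y. cond_value (n - k) (case_nat (F k (s, y)) s)"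
  define c where "c = diag_coeff a (n - k)"
  have c0: "c \<ge> 0" unfolding c_def using diag_ge_1[of "n - k"] by simp
  interpret L: prob_space "law k" using k by (intro prob_space_law) simp
  have g: "integrable (law k) ?g" by (rule step_integrable[OF k s step_lipschitz[OF k s]])
  have "incr k (s, z) = (\<integral>y. ?g z - ?g y \<partial>law k)"
    using g L.prob_space unfolding incr_def by (simp only: cond_value_Suc[OF k]) simp
  then have "ennreal \<bar>incr k (s, z)\<bar> \<le> (\<integral>\<^sup>+y. ennreal (norm (?g z - ?g y)) \<partial>law k)"
    using integral_norm_bound_ennreal[of "law k" "\<lambda>y. ?g z - ?g y"] g by simp
  also have "\<dots> \<le> (\<integral>\<^sup>+y. ennreal c * ennreal (dist (F k (s, z)) (F k (s, y))) \<partial>law k)"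
    using step_lipschitz[OF k s] c0
    by (intro nn_integral_mono) (simp add: c_def ennreal_mult[symmetric] ennreal_leI)
  also have "\<dots> = ennreal c * H_dist (F k) (law k) s z"
    unfolding H_dist_def using k F_section_meas[of k s] by (intro nn_integral_cmult) simp
  finally show ?thesis by (simp add: c_def)
qed

definition mdiff :: "nat \<Rightarrow> 'w \<Rightarrow> real" where
  "mdiff k \<omega> = incr k (past X k \<omega>, \<epsilon> k \<omega>)"

lemma mdiff_meas: "k \<in> {1..n} \<Longrightarrow> mdiff k \<in> borel_measurable M"
  using measurable_compose[OF measurable_Pair[OF past_meas eps_meas] incr_meas, of k]
  by (simp add: mdiff_def[abs_def])

text \<open>Written with \<open>n - (k - 1)\<close>, the two terms are consecutive values of one
  sequence indexed by \<open>k\<close>, which lets the sum telescope.\<close>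

lemma mdiff_eq:
  assumes "k \<in> {1..n}" "\<omega> \<in> space M"
  shows "mdiff k \<omega> = cond_value (n - k) (past X (Suc k) \<omega>) - cond_value (n - (k - 1)) (past X k \<omega>)"
proof -
  have "Suc (n - k) = n - (k - 1)" "k \<ge> 1" using assms(1) by auto
  then show ?thesis using past_Suc[of k \<omega>] assms(2) by (simp only: mdiff_def incr_def prod.case)
qed

lemma mdiff_tail:
  assumes k: "k \<in> {1..n}" and t: "t > 0"
  shows "prob {\<omega> \<in> space M. \<bar>mdiff k \<omega>\<bar> > t} \<le> diag_coeff a (n - k) powr p * A k / t powr p"
proof -
  define c where "c = diag_coeff a (n - k)"
  have c: "c > 0" unfolding c_def using diag_ge_1[of "n - k"] by simp
  have k1: "k \<ge> 1" using k by simp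
  let ?H = "\<lambda>\<omega>. H_dist (F k) (law k) (past X k \<omega>) (\<epsilon> k \<omega>)"
  note [measurable] = H_past_meas[OF k1]
  have "prob {\<omega> \<in> space M. \<bar>mdiff k \<omega>\<bar> > t} \<le> prob {\<omega> \<in> space M. ?H \<omega> > ennreal (t / c)}"
  proof (intro finite_measure_mono subsetI)
    fix \<omega> assume \<omega>: "\<omega> \<in> {\<omega> \<in> space M. \<bar>mdiff k \<omega>\<bar> > t}"
    then have le: "ennreal \<bar>mdiff k \<omega>\<bar> \<le> ennreal c * ?H \<omega>"
      unfolding mdiff_def c_def by (intro incr_le_H_dist[OF k] past_tail_fixed'[OF k1]) simp
    have "t < c * r" if "?H \<omega> = ennreal r" "r \<ge> 0" for r
    proof -
      have "ennreal \<bar>mdiff k \<omega>\<bar> \<le> ennreal (c * r)" using le that c by (simp add: ennreal_mult)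
      then show ?thesis using \<omega> that c by (simp add: ennreal_le_iff2) (smt (verit) mult_nonneg_nonneg)
    qed
    then show "\<omega> \<in> {\<omega> \<in> space M. ?H \<omega> > ennreal (t / c)}"
      using \<omega> c t by (cases "?H \<omega>") (auto simp: ennreal_less_iff field_simps)
  qed simp
  also have "\<dots> \<le> A k / (t / c) powr p"
    using t c by (intro weak_moment_tail weak[OF k]) simp
  also have "\<dots> = c powr p * A k / t powr p"
    using t c by (simp add: powr_divide)
  finally show ?thesis by (simp add: c_def)
qed

lemma A_nonneg: "k \<in> {1..n} \<Longrightarrow> A k \<ge> 0"
  using order_trans[OF measure_nonneg weak_moment_tail[OF weak, of k 1]] by simp

lemma mdiff_integrable: "k \<in> {1..n} \<Longrightarrow> integrable M (mdiff k)"
  by (rule integrable_weak_tail[OF mdiff_meas mdiff_tail p(1)]) (simp_all add: A_nonneg)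

text \<open>The information strictly before time \<open>k\<close>. Generating it by the whole past
  as one sequence-valued variable makes each of its sets a preimage under \<open>past X k\<close>,
  ready for integration with the past frozen.\<close>

definition filt :: "nat \<Rightarrow> 'w measure" where
  "filt k = vimage_algebra (space M) (past X k) seq_algebra"

lemma filt_subalgebra: "k \<ge> 1 \<Longrightarrow> subalgebra M (filt k)"
  unfolding subalgebra_def filt_def
  by (simp add: sets_image_in_sets[OF refl past_meas])

text \<open>An earlier past is a later one shifted by \<open>k - j\<close> positions.\<close>

lemma past_filt_meas:
  assumes "1 \<le> j" "j \<le> k"
  shows "past X j \<in> filt k \<rightarrow>\<^sub>M seq_algebra"
proof -
  have "past X k \<in> filt k \<rightarrow>\<^sub>M seq_algebra"
    unfolding filt_def by (rule measurable_vimage_algebra1) (simp add: space_PiM)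
  then have "(\<lambda>\<omega>. past X k \<omega> (i + (k - j))) \<in> borel_measurable (filt k)" for i
    by (rule measurable_compose) (simp add: measurable_component_singleton)
  moreover have "past X k \<omega> (i + (k - j)) = past X j \<omega> i" for \<omega> i
    using assms by (auto simp: past_def of_nat_diff intro!: arg_cong[where f = "\<lambda>j. X j \<omega>"])
  ultimately show ?thesis by (intro measurable_PiM_single') (auto simp: PiE_def)
qed

lemma filt_mono:
  assumes "1 \<le> j" "j \<le> k"
  shows "subalgebra (filt k) (filt j)"
proof -
  have "space (filt k) = space M" by (simp add: filt_def)
  from sets_image_in_sets[OF this past_filt_meas[OF assms]] show ?thesis
    by (simp add: subalgebra_def filt_def)
qed

text \<open>The innovation in \<open>mdiff j\<close> need not be a function of the past. By
  \<open>mdiff_eq\<close>, however, it enters only through \<open>past X (Suc j)\<close>, which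
  \<open>filt k\<close> knows as soon as \<open>j < k\<close>.\<close>

lemma mdiff_adapted:
  assumes "1 \<le> j" "j < k" "k \<le> n"
  shows "mdiff j \<in> borel_measurable (filt k)"
proof -
  have j: "j \<in> {1..n}" using assms by simp
  have "(\<lambda>\<omega>. cond_value (n - j) (past X (Suc j) \<omega>) - cond_value (n - (j - 1)) (past X j \<omega>)) \<in> borel_measurable (filt k)"
    using assms
    by (intro borel_measurable_diff measurable_compose[OF past_filt_meas cond_value_meas]) auto
  then show ?thesis
    by (rule measurable_cong[THEN iffD1, rotated]) (simp add: mdiff_eq[OF j] filt_def)
qed

text \<open>It suffices to test against sets of \<open>filt k\<close>. Their indicators depend on
  the past alone, so with the past frozen the inner integral is a multiple of the mean of
  \<open>incr k\<close> over the innovation, which is 0 by construction of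
  \<open>cond_value\<close>.\<close>

lemma cond_exp_mdiff_zero:
  assumes k: "k \<in> {1..n}"
  shows "AE \<omega> in M. real_cond_exp M (filt k) (mdiff k) \<omega> = 0"
proof -
  have k1: "k \<ge> 1" using k by simp
  interpret finite_measure_subalgebra M "filt k"
    by (rule finite_measure_subalgebraI[OF filt_subalgebra[OF k1]])
  interpret L: prob_space "law k" by (rule prob_space_law[OF k1])
  show ?thesis
  proof (rule real_cond_exp_charact)
    fix B assume "B \<in> sets (filt k)"
    then obtain C where C [measurable]: "C \<in> sets seq_algebra" and B: "B = past X k -` C \<inter> space M"
      unfolding filt_def by (auto simp: sets_vimage_algebra2 space_PiM)
    define h where "h = (\<lambda>z. indicator C (fst z) * incr k z :: real)"
    note [measurable] = incr_meas[OF k]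
    have h: "h \<in> borel_measurable (seq_algebra \<Otimes>\<^sub>M borel)" unfolding h_def by measurable
    have hB: "h (past X k \<omega>, \<epsilon> k \<omega>) = indicator B \<omega> *\<^sub>R mdiff k \<omega>" if "\<omega> \<in> space M" for \<omega>
      using that by (simp add: h_def mdiff_def B indicator_def)
    have "B \<in> sets M" unfolding B using measurable_sets[OF past_meas[OF k1] C] .
    then have "integrable M (\<lambda>\<omega>. indicator B \<omega> *\<^sub>R mdiff k \<omega>)"
      using mdiff_integrable[OF k] by (rule integrable_mult_indicator)
    then have "integrable M (\<lambda>\<omega>. h (past X k \<omega>, \<epsilon> k \<omega>))"
      by (rule Bochner_Integration.integrable_cong[THEN iffD1, rotated -1]) (simp_all add: hB)
    then have "(\<integral>\<omega>. h (past X k \<omega>, \<epsilon> k \<omega>) \<partial>M) = (\<integral>\<omega>. (\<integral>y. h (past X k \<omega>, y) \<partial>law k) \<partial>M)"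
      by (rule integral_past_eps[OF k1 h])
    also have "\<dots> = (\<integral>\<omega>. 0 \<partial>M)"
    proof (intro Bochner_Integration.integral_cong refl)
      fix \<omega> assume "\<omega> \<in> space M"
      then have s: "past X k \<omega> \<in> tail_fixed (k - 1)" by (rule past_tail_fixed'[OF k1])
      have "(\<integral>y. incr k (past X k \<omega>, y) \<partial>law k) = 0"
        using step_integrable[OF k s step_lipschitz[OF k s]] L.prob_space
        unfolding incr_def by (simp only: cond_value_Suc[OF k]) simp
      then show "(\<integral>y. h (past X k \<omega>, y) \<partial>law k) = 0" by (simp add: h_def)
    qed
    also have "(\<integral>\<omega>. h (past X k \<omega>, \<epsilon> k \<omega>) \<partial>M) = (\<integral>\<omega>\<in>B. mdiff k \<omega> \<partial>M)"
      unfolding set_lebesgue_integral_def by (intro Bochner_Integration.integral_cong refl hB)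
    finally show "(\<integral>\<omega>\<in>B. mdiff k \<omega> \<partial>M) = (\<integral>\<omega>\<in>B. 0 \<partial>M)"
      by (simp add: set_lebesgue_integral_def)
  qed (use mdiff_integrable[OF k] in auto)
qed

text \<open>The telescoping sum starts from a deterministic value \<open>v\<close>, since the past
  of time 1 is prescribed. As the differences are integrable with mean 0, \<open>v\<close> is the
  expectation subtracted in \<open>S_dev\<close>.\<close>

lemma S_dev_eq_sum:
  assumes \<omega>: "\<omega> \<in> space M"
  shows "S_dev M X f n \<omega> = (\<Sum>k = 1..n. mdiff k \<omega>)"
proof -
  define v where "v = cond_value n (\<lambda>i. x0 (- int i))"
  have f_eq: "f (\<lambda>i\<in>{1..n}. X (int i) \<omega>) = v + (\<Sum>k = 1..n. mdiff k \<omega>)" if \<omega>: "\<omega> \<in> space M" for \<omega>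
  proof -
    let ?g = "\<lambda>k. cond_value (n - k) (past X (Suc k) \<omega>)"
    have "(\<Sum>k = 1..n. mdiff k \<omega>) = (\<Sum>k = Suc 0..n. ?g k - ?g (k - 1))"
      by (intro sum.cong refl) (auto simp: mdiff_eq[OF _ \<omega>])
    also have "\<dots> = cond_value (n - n) (past X (Suc n) \<omega>) - cond_value (n - 0) (past X (Suc 0) \<omega>)"
      by (rule sum_telescope''[where f = ?g]) simp
    also have "cond_value (n - 0) (past X (Suc 0) \<omega>) = v"
      using past_one[OF \<omega>] by (simp add: v_def)
    also have "cond_value (n - n) (past X (Suc n) \<omega>) = f (\<lambda>i\<in>{1..n}. X (int i) \<omega>)"
      by (auto simp: past_def of_nat_diff intro!: arg_cong[where f = f])
    finally show ?thesis by simp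
  qed
  have "(\<integral>\<omega>. mdiff k \<omega> \<partial>M) = 0" if k: "k \<in> {1..n}" for k
  proof -
    interpret finite_measure_subalgebra M "filt k"
      by (rule finite_measure_subalgebraI[OF filt_subalgebra]) (use k in auto)
    have "(\<integral>\<omega>. mdiff k \<omega> \<partial>M) = (\<integral>\<omega>. real_cond_exp M (filt k) (mdiff k) \<omega> \<partial>M)"
      using real_cond_exp_int(2)[OF mdiff_integrable[OF k]] by simp
    also have "\<dots> = (\<integral>\<omega>. 0 \<partial>M)"
      using cond_exp_mdiff_zero[OF k] by (intro integral_cong_AE) auto
    finally show ?thesis by simp
  qed
  then have "(\<integral>\<omega>. (\<Sum>k = 1..n. mdiff k \<omega>) \<partial>M) = 0"
    using mdiff_integrable by (subst Bochner_Integration.integral_sum) auto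
  then have "(\<integral>\<omega>. v + (\<Sum>k = 1..n. mdiff k \<omega>) \<partial>M) = v"
    using mdiff_integrable
    by (subst Bochner_Integration.integral_add) (auto simp: prob_space intro!: Bochner_Integration.integrable_sum)
  then have "(\<integral>\<omega>. f (\<lambda>i\<in>{1..n}. X (int i) \<omega>) \<partial>M) = v"
    using f_eq by (simp cong: Bochner_Integration.integral_cong)
  then show ?thesis using f_eq[OF \<omega>] by (simp add: S_dev_def)
qed

section \<open>The deviation inequality\<close>

lemma deviation_bound:
  assumes x: "x > 0"
  shows "prob {\<omega> \<in> space M. \<bar>S_dev M X f n \<omega>\<bar> \<ge> x} \<le> C_const p * B_const a A n p / x powr p"
proof -
  have "{\<omega> \<in> space M. \<bar>S_dev M X f n \<omega>\<bar> \<ge> x} = {\<omega> \<in> space M. \<bar>\<Sum>k = 1..n. mdiff k \<omega>\<bar> \<ge> x}"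
    using S_dev_eq_sum by auto
  also have "prob \<dots> \<le> C_const p * (\<Sum>k = 1..n. diag_coeff a (n - k) powr p * A k) / x powr p"
    using p x mdiff_meas mdiff_adapted mdiff_tail cond_exp_mdiff_zero
    by (intro weak_type_martingale_inequality[where G = filt])
       (auto simp: A_nonneg intro!: filt_subalgebra filt_mono)
  finally show ?thesis by (simp add: B_const_def)
qed

end

theorem proposition4p11:
  fixes M :: "'w measure"
    and \<epsilon> :: "nat \<Rightarrow> 'w \<Rightarrow> 'y::polish_space"
    and F :: "nat \<Rightarrow> (nat \<Rightarrow> 'x::polish_space) \<times> 'y \<Rightarrow> 'x"
    and X :: "int \<Rightarrow> 'w \<Rightarrow> 'x"
    and x0 :: "int \<Rightarrow> 'x"
    and a A :: "nat \<Rightarrow> real"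
    and n :: nat
    and f :: "(nat \<Rightarrow> 'x) \<Rightarrow> real"
    and p :: real
  assumes "prob_space M"
    and "prob_space.indep_vars M (\<lambda>_. borel) \<epsilon> {1..}"
    and "\<And>m. m \<ge> 1 \<Longrightarrow> F m \<in> (\<Pi>\<^sub>M i\<in>UNIV. borel) \<Otimes>\<^sub>M borel \<rightarrow>\<^sub>M borel"
    and "\<And>j \<omega>. j \<le> 0 \<Longrightarrow> \<omega> \<in> space M \<Longrightarrow> X j \<omega> = x0 j"
    and "\<And>m \<omega>. m \<ge> 1 \<Longrightarrow> \<omega> \<in> space M \<Longrightarrow> X (int m) \<omega> = F m (past X m \<omega>, \<epsilon> m \<omega>)"
    and "\<And>i. i \<ge> 1 \<Longrightarrow> a i \<ge> 0"
    and "summable (\<lambda>i. a (Suc i))"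
    and "(\<Sum>i. a (Suc i)) < 1"
    and "\<And>m s s'. m \<ge> 1 \<Longrightarrow>
           (\<integral>\<^sup>+ \<omega>. ennreal (dist (F m (s, \<epsilon> m \<omega>)) (F m (s', \<epsilon> m \<omega>))) \<partial>M)
             \<le> (\<Sum>i. ennreal (a (Suc i) * dist (s i) (s' i)))"
    and "n \<ge> 1"
    and "\<And>u v. u \<in> {1..n} \<rightarrow>\<^sub>E UNIV \<Longrightarrow> v \<in> {1..n} \<rightarrow>\<^sub>E UNIV \<Longrightarrow>
           \<bar>f u - f v\<bar> \<le> (\<Sum>i = 1..n. dist (u i) (v i))"
    and "1 < p" and "p < 2"
    and "\<And>k. k \<in> {1..n} \<Longrightarrow>
           weak_moment M p
             (\<lambda>\<omega>. enn2ereal (H_dist (F k) (distr M borel (\<epsilon> k)) (past X k \<omega>) (\<epsilon> k \<omega>)))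
             \<le> ereal (A k)"
  shows "\<forall>x>0. measure M {\<omega> \<in> space M. \<bar>S_dev M X f n \<omega>\<bar> \<ge> x}
                 \<le> C_const p * B_const a A n p / x powr p"
proof -
  interpret prob_space M by fact
  interpret contractive_recursion M \<epsilon> F X x0 a A n f p
    by unfold_locales (fact assms)+
  show ?thesis using deviation_bound by simp
qed

end
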